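(* Let $k\neq 0$, $c_g,c_f>0$, $\lambda>0$, and $$f(y)=\frac{1}{2c_f}y^2,\quad g(x)=\frac{1}{2c_g}x^2,\quad h(x)=f(kx)+g(x)=\frac{k^2c_g+c_f}{2c_fc_g}x^2,\qquad x,y\in\mathbb{R},$$ and let $\mu^\ast$ be the probability distribution on $\mathbb{R}$ with density $\mu^\ast(x)\propto\exp(-h(x))$. Consider the diffusion for $Z_t=(X_t,Y_t)^T\in\mathbb{R}^2$, $$\mathrm{d}Z_t=-A Z_t\,\mathrm{d}t+B\,\mathrm{d}W_t,\qquad A=\begin{pmatrix}c_g^{-1}&k\\-\lambda k&\lambda c_f\end{pmatrix},\quad B=\begin{pmatrix}\sqrt2\\0\end{pmatrix},$$ where $W_t$ is one-dimensional Brownian motion. Then: (i) For any (possibly singular) initial distribution $\pi_0$ with $Z_0\sim\pi_0$, the distribution $\pi_t=\mathrm{Law}(Z_t)$ has a $C^\infty$-smooth Lebesgue density for every $t>0$. (ii) If $\pi_0$ is Gaussian (including degenerate Gaussians with singular covariance matrix), then $\pi_t$ is a non-degenerate Gaussian for all $t>0$. As $t\to\infty$, $\pi_t$ converges to the Gaussian stationary distribution $\pi_\lambda$ with mean zero and covariance matrix $$\frac{1}{(c_f+k^2c_g)(1+\lambda c_fc_g)}\begin{pmatrix}c_g(c_f+k^2c_g)+\lambda c_f^2c_g^2& k\lambda c_fc_g^2\\ k\lambda c_fc_g^2& k^2\lambda c_g^2\end{pmatrix}.$$ The $x$-marginal $\mu_\lambda$ of $\pi_\lambda$ is not equal to $\mu^\ast$.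 However, the limiting joint distribution of $\pi_\lambda$ as $\lambda\to\infty$ is the degenerate Gaussian $(\mathrm{id},f'(k\,\cdot))_{\#}\mu^\ast$, whose $x$-marginal is $\mu^\ast$.
   Context: $(\mathrm{id},f'(k\,\cdot))_{\#}\mu^\ast$ denotes the push-forward of $\mu^\ast$ under $x\mapsto(x,f'(kx))$. The $x$-marginal is the law of the first coordinate. This diffusion is the primal-dual Langevin diffusion $\mathrm{d}X_t=-(g'(X_t)+kY_t)\mathrm{d}t+\sqrt2\,\mathrm{d}W_t$, $\mathrm{d}Y_t=-\lambda((f^\ast)'(Y_t)-kX_t)\mathrm{d}t$, where $f^\ast(y)=\frac{c_f}{2}y^2$ is the convex conjugate of $f$. *)

theory Defs
  imports "HOL-Probability.Probability"
begin

text \<open>Normal law on the line, parametrised by its variance; variance zero gives a point mass.\<close>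

definition normal_law :: "real \<Rightarrow> real \<Rightarrow> real measure" where
  "normal_law m v =
     (if v = 0 then return borel m else density lborel (normal_density m (sqrt v)))"

text \<open>
  Gaussian laws on \<open>\<real>\<^sup>n\<close>, possibly degenerate: every linear functional is normally distributed.
  The mean \<open>m\<close> and the covariance matrix \<open>S\<close> are determined by the law. Positive
  semidefiniteness is demanded explicitly because \<^const>\<open>normal_density\<close> only depends on the
  square of its second parameter, so that a negative variance would not be excluded otherwise.
\<close>

definition gaussian :: "real ^ 'n \<Rightarrow> real ^ 'n ^ 'n \<Rightarrow> (real ^ 'n) measure \<Rightarrow> bool" where
  "gaussian m S \<mu> \<longleftrightarrow>
     prob_space \<mu> \<and> sets \<mu> = sets borel \<and>
     transpose S = S \<and> (\<forall>u. 0 \<le> u \<bullet> (S *v u)) \<and>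
     (\<forall>u. distr \<mu> borel (\<lambda>z. u \<bullet> z) = normal_law (u \<bullet> m) (u \<bullet> (S *v u)))"

definition is_gaussian :: "(real ^ 'n) measure \<Rightarrow> bool" where
  "is_gaussian \<mu> \<longleftrightarrow> (\<exists>m S. gaussian m S \<mu>)"

definition nondegenerate_gaussian :: "(real ^ 'n) measure \<Rightarrow> bool" where
  "nondegenerate_gaussian \<mu> \<longleftrightarrow> (\<exists>m S. gaussian m S \<mu> \<and> invertible S)"

definition degenerate_gaussian :: "(real ^ 'n) measure \<Rightarrow> bool" where
  "degenerate_gaussian \<mu> \<longleftrightarrow> (\<exists>m S. gaussian m S \<mu> \<and> \<not> invertible S)"

text \<open>The probability measure on the line with Lebesgue density proportional to \<open>exp (- h)\<close>.\<close>

definition gibbs_measure :: "(real \<Rightarrow> real) \<Rightarrow> real measure" where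
  "gibbs_measure h = density lborel (\<lambda>x. exp (- h x) / (LINT y|lborel. exp (- h y)))"

definition weakly_converges ::
    "('i \<Rightarrow> 'a::topological_space measure) \<Rightarrow> 'a measure \<Rightarrow> 'i filter \<Rightarrow> bool" where
  "weakly_converges N \<nu> F \<longleftrightarrow>
     (\<forall>\<phi>::'a \<Rightarrow> real. continuous_on UNIV \<phi> \<and> bounded (range \<phi>) \<longrightarrow>
        ((\<lambda>i. \<integral>z. \<phi> z \<partial>N i) \<longlongrightarrow> (\<integral>z. \<phi> z \<partial>\<nu>)) F)"

text \<open>
  \<open>n\<close>-fold continuous differentiability through iterated directional derivatives; this is the
  usual notion since the domain is finite-dimensional.
\<close>

primrec times_cont_differentiable ::
    "nat \<Rightarrow> ('a::euclidean_space \<Rightarrow> 'b::real_normed_vector) \<Rightarrow> bool" where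
  "times_cont_differentiable 0 f \<longleftrightarrow> continuous_on UNIV f"
| "times_cont_differentiable (Suc n) f \<longleftrightarrow>
     (\<forall>x. f differentiable (at x)) \<and>
     (\<forall>v. times_cont_differentiable n (\<lambda>x. frechet_derivative f (at x) v))"

definition smooth :: "('a::euclidean_space \<Rightarrow> 'b::real_normed_vector) \<Rightarrow> bool" where
  "smooth f \<longleftrightarrow> (\<forall>n. times_cont_differentiable n f)"

definition has_smooth_density :: "'a::euclidean_space measure \<Rightarrow> bool" where
  "has_smooth_density \<mu> \<longleftrightarrow>
     (\<exists>p :: 'a \<Rightarrow> real. smooth p \<and> (\<forall>z. 0 \<le> p z) \<and> \<mu> = density lborel (\<lambda>z. ennreal (p z)))"

text \<open>
  Time is modelled by \<open>real\<close>; only the indices \<open>t \<ge> 0\<close> of filtrations and processes matter.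
\<close>

definition brownian_motion ::
    "'a measure \<Rightarrow> (real \<Rightarrow> 'a measure) \<Rightarrow> (real \<Rightarrow> 'a \<Rightarrow> real) \<Rightarrow> bool" where
  "brownian_motion M F W \<longleftrightarrow>
     prob_space M \<and>
     (\<forall>t\<ge>0. subalgebra M (F t)) \<and>
     (\<forall>s\<ge>0. \<forall>t\<ge>s. subalgebra (F t) (F s)) \<and>
     (\<forall>t\<ge>0. W t \<in> borel_measurable (F t)) \<and>
     (AE \<omega> in M. W 0 \<omega> = 0) \<and>
     (\<forall>s\<ge>0. \<forall>t>s.
        prob_space.indep_set M (sets (F s))
          (sets (vimage_algebra (space M) (\<lambda>\<omega>. W t \<omega> - W s \<omega>) borel)) \<and>
        distr M borel (\<lambda>\<omega>. W t \<omega> - W s \<omega>) = normal_law 0 (t - s)) \<and>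
     (AE \<omega> in M. continuous_on {0..} (\<lambda>t. W t \<omega>))"

text \<open>
  Solutions of \<open>dZ = - A Z dt + B dW\<close> with driving Brownian motion \<open>W\<close> relative to the
  filtration \<open>F\<close>. The noise coefficient is a constant column, hence the stochastic integral of \<open>B\<close>
  up to time \<open>t\<close> is \<open>W t *\<^sub>R B\<close>. That \<open>Z 0\<close> is independent of \<open>W\<close> follows from adaptedness.
\<close>

definition linear_sde_solution ::
    "real ^ 'n ^ 'n \<Rightarrow> real ^ 'n \<Rightarrow> 'a measure \<Rightarrow> (real \<Rightarrow> 'a measure) \<Rightarrow>
     (real \<Rightarrow> 'a \<Rightarrow> real) \<Rightarrow> (real \<Rightarrow> 'a \<Rightarrow> real ^ 'n) \<Rightarrow> bool" where
  "linear_sde_solution A B M F W Z \<longleftrightarrow>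
     brownian_motion M F W \<and>
     (\<forall>t\<ge>0. Z t \<in> borel_measurable (F t)) \<and>
     (AE \<omega> in M. continuous_on {0..} (\<lambda>t. Z t \<omega>)) \<and>
     (AE \<omega> in M. \<forall>t\<ge>0.
        Z t \<omega> = Z 0 \<omega> + integral {0..t} (\<lambda>s. - (A *v Z s \<omega>)) + W t \<omega> *\<^sub>R B)"

definition drift_matrix :: "real \<Rightarrow> real \<Rightarrow> real \<Rightarrow> real \<Rightarrow> real ^ 2 ^ 2" where
  "drift_matrix k cg cf l = vector [vector [inverse cg, k], vector [- l * k, l * cf]]"

definition noise_vector :: "real ^ 2" where
  "noise_vector = vector [sqrt 2, 0]"

definition stationary_covariance :: "real \<Rightarrow> real \<Rightarrow> real \<Rightarrow> real \<Rightarrow> real ^ 2 ^ 2" where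
  "stationary_covariance k cg cf l =
     (1 / ((cf + k\<^sup>2 * cg) * (1 + l * cf * cg))) *\<^sub>R
     vector [vector [cg * (cf + k\<^sup>2 * cg) + l * cf\<^sup>2 * cg\<^sup>2, k * l * cf * cg\<^sup>2],
             vector [k * l * cf * cg\<^sup>2, k\<^sup>2 * l * cg\<^sup>2]]"

end

theory Submission
  imports Defs
begin

text \<open>
  Everything is done with characteristic functions. Fix a direction \<open>u\<close> and a time \<open>t\<close>, and let
  \<open>a\<close> solve the adjoint equation \<open>a' = A\<^sup>T a\<close> with \<open>a t = u\<close>. Then \<open>d(a \<bullet> Z) = (a \<bullet> B) dW\<close>, because
  the two drift terms cancel, so \<open>u \<bullet> Z\<^sub>t\<close> is \<open>a 0 \<bullet> Z\<^sub>0\<close> plus a Wiener integral of a deterministic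
  function. That integral is a pathwise limit of sums of independent increments, and therefore
  (\<open>linear_sde_mchar\<close>) the characteristic function of \<open>Z\<^sub>t\<close> at \<open>u\<close> is that of \<open>Z\<^sub>0\<close> at \<open>a 0\<close> times
  \<open>exp (- q / 2)\<close>, where \<open>q\<close> is the integral of \<open>(a \<bullet> B)\<^sup>2\<close> over \<open>[0, t]\<close>.

  The proposed stationary covariance \<open>S\<close> solves the Lyapunov equation \<open>A S + S A\<^sup>T = B B\<^sup>T\<close>. Hence
  \<open>(a \<bullet> B)\<^sup>2\<close> is the derivative of \<open>a \<bullet> S a\<close>, and \<open>q = u \<bullet> S u - a 0 \<bullet> S (a 0)\<close>. With \<open>E t = exp (- t A)\<close>
  this says that the transition covariance is \<open>S - E t S (E t)\<^sup>T\<close>. It is positive definite for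
  \<open>t > 0\<close>, since \<open>q = 0\<close> would force \<open>a\<close> to be orthogonal to \<open>B\<close> and to \<open>A B\<close>, and these span the
  plane when \<open>l k \<noteq> 0\<close> (\<open>inner_cov_pos\<close>). This is how noise in the first coordinate alone reaches
  both coordinates.

  All claims about the diffusion follow. By uniqueness of characteristic functions in the plane
  (\<open>mchar_unique_2\<close>), the law of \<open>Z\<^sub>t\<close> is that of \<open>E t Z\<^sub>0 + N\<close> with \<open>N\<close> an independent
  nondegenerate Gaussian. So it has as density a convolution of a probability measure with a
  Gaussian density, which is smooth. A Gaussian initial law gives a Gaussian law with
  covariance \<open>E t S\<^sub>0 (E t)\<^sup>T + S - E t S (E t)\<^sup>T\<close>, which is positive definite, equals \<open>S\<close> when
  \<open>S\<^sub>0 = S\<close>, and tends to \<open>S\<close> because \<open>E t\<close> tends to \<open>0\<close>. Convergence of the mean and of the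
  covariance implies weak convergence (\<open>gaussian_weakly_converges\<close>), also when the limit is
  degenerate. The same lemma handles the limit of \<open>\<pi>\<^sub>\<lambda>\<close> as \<open>\<lambda>\<close> grows, whose covariance is the rank
  one matrix of the graph law of \<open>x \<mapsto> k x / c\<^sub>f\<close>. Finally, the first marginal of \<open>\<pi>\<^sub>\<lambda>\<close> has a variance
  different from that of the target, and the difference is caused by \<open>k\<^sup>2 c\<^sub>g \<noteq> 0\<close>.
\<close>

section \<open>Characteristic functions in the plane\<close>

definition mchar :: "'a::euclidean_space measure \<Rightarrow> 'a \<Rightarrow> complex" where
  "mchar \<mu> u = (CLINT z|\<mu>. iexp (u \<bullet> z))"

lemma mchar_distr:
  assumes "X \<in> borel_measurable M"
  shows "mchar (distr M borel X) u = (CLINT \<omega>|M. iexp (u \<bullet> X \<omega>))"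
  unfolding mchar_def using assms by (subst integral_distr) auto

lemma char_distr_inner:
  assumes "sets \<mu> = sets borel"
  shows "char (distr \<mu> borel (\<lambda>z. u \<bullet> z)) s = mchar \<mu> (s *\<^sub>R u)"
proof -
  have [measurable_cong]: "sets \<mu> = sets borel" by fact
  show ?thesis
    unfolding mchar_def char_def by (subst integral_distr) (auto simp: inner_scaleR_left)
qed

text \<open>
  Uniqueness is known for probability measures; a nonzero finite measure is a multiple of one,
  and its mass is its characteristic function at \<open>0\<close>.
\<close>

lemma finite_measure_eqI_char:
  fixes M N :: "real measure"
  assumes M: "finite_measure M" "sets M = sets borel"
    and N: "finite_measure N" "sets N = sets borel"
    and eq: "\<And>t. (CLINT x|M. iexp (t * x)) = (CLINT x|N. iexp (t * x))"
  shows "M = N"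
proof -
  have sp: "space M = UNIV" "space N = UNIV"
    using M(2) N(2) by (auto dest: sets_eq_imp_space_eq)
  define c where "c = measure M UNIV"
  interpret M: finite_measure M by fact
  interpret N: finite_measure N by fact
  have cN: "measure N UNIV = c"
    using eq[of 0] by (simp add: c_def sp)
  show ?thesis
  proof (cases "c = 0")
    case True
    have "emeasure M A = emeasure N A" for A
    proof -
      have "emeasure M A \<le> emeasure M UNIV" "emeasure N A \<le> emeasure N UNIV"
        using emeasure_space[of M A] emeasure_space[of N A] by (auto simp: sp)
      then show ?thesis
        using True cN
        by (simp add: measure_le_0_iff c_def M.emeasure_eq_measure N.emeasure_eq_measure)
    qed
    then show ?thesis using M(2) N(2) by (intro measure_eqI) auto
  next
    case False
    then have c: "c > 0" using zero_less_measure_iff[of M UNIV] by (simp add: c_def)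
    define M' N' where "M' = density M (\<lambda>_. ennreal (1 / c))"
      and "N' = density N (\<lambda>_. ennreal (1 / c))"
    have "real_distribution M'" "real_distribution N'"
      unfolding M'_def N'_def real_distribution_def real_distribution_axioms_def
      using M N c cN
      by (auto intro!: prob_spaceI simp: emeasure_density_const sp c_def[symmetric]
          M.emeasure_eq_measure N.emeasure_eq_measure simp flip: ennreal_mult)
    moreover have "char M' = char N'"
    proof
      fix t
      have [measurable_cong]: "sets M = sets borel" "sets N = sets borel" using M N by auto
      show "char M' t = char N' t"
        unfolding char_def M'_def N'_def using c
        by (subst (1 2) integral_density) (auto simp: eq[simplified])
    qed
    ultimately have eq': "M' = N'" by (rule Levy_uniqueness)
    show ?thesis
    proof (rule measure_eqI)
      fix A assume A: "A \<in> sets M"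
      have "emeasure M' A = emeasure N' A" using eq' by simp
      then have "ennreal (1/c) * emeasure M A = ennreal (1/c) * emeasure N A"
        using A M N by (simp add: M'_def N'_def emeasure_density_const)
      then show "emeasure M A = emeasure N A"
        using c by (simp add: M.emeasure_eq_measure N.emeasure_eq_measure flip: ennreal_mult)
    qed (use M N in auto)
  qed
qed

lemma inner_2: "(u::real^2) \<bullet> z = u $ 1 * z $ 1 + u $ 2 * z $ 2"
  by (simp add: inner_vec_def sum_2)

text \<open>
  The one-dimensional uniqueness theorem applied to the image under \<open>X\<close> of the measure with
  density \<open>v\<close>. It is what allows one coordinate of a planar law to be handled at a time.
\<close>

lemma weighted_marginal_eqI:
  fixes \<mu> \<nu> :: "'a measure" and X v :: "'a \<Rightarrow> real"
  assumes M: "finite_measure \<mu>" and N: "finite_measure \<nu>" and sets: "sets \<mu> = sets \<nu>"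
    and X[measurable]: "X \<in> borel_measurable \<mu>"
    and v[measurable]: "v \<in> borel_measurable \<mu>" and b: "\<And>z. 0 \<le> v z" "\<And>z. v z \<le> K"
    and eq: "\<And>t. (CLINT z|\<mu>. v z *\<^sub>R iexp (t * X z)) = (CLINT z|\<nu>. v z *\<^sub>R iexp (t * X z))"
    and A[measurable]: "A \<in> sets borel"
  shows "(\<integral>z. v z * indicator A (X z) \<partial>\<mu>) = (\<integral>z. v z * indicator A (X z) \<partial>\<nu>)"
proof -
  interpret M: finite_measure \<mu> by fact
  interpret N: finite_measure \<nu> by fact
  have [measurable]: "X \<in> borel_measurable \<nu>" "v \<in> borel_measurable \<nu>"
    using X v sets by (auto cong: measurable_cong_sets)
  have fin: "finite_measure (distr (density \<rho> v) borel X)"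
    if "finite_measure \<rho>" "sets \<rho> = sets \<mu>" for \<rho> :: "'a measure"
  proof -
    interpret R: finite_measure \<rho> by fact
    have [measurable]: "X \<in> borel_measurable \<rho>" "v \<in> borel_measurable \<rho>"
      using X v that(2) by (auto cong: measurable_cong_sets)
    have "(\<integral>\<^sup>+z. ennreal (v z) \<partial>\<rho>) \<le> (\<integral>\<^sup>+z. ennreal K \<partial>\<rho>)"
      using b by (intro nn_integral_mono ennreal_leI) auto
    also have "\<dots> < \<infinity>"
      by (simp add: ennreal_mult_less_top R.emeasure_eq_measure)
    finally have "finite_measure (density \<rho> v)"
      by (intro finite_measureI) (auto simp: emeasure_density)
    then show ?thesis by (rule finite_measure.finite_measure_distr) auto
  qed
  have "distr (density \<mu> v) borel X = distr (density \<nu> v) borel X"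
  proof (rule finite_measure_eqI_char)
    fix t
    show "(CLINT x|distr (density \<mu> v) borel X. iexp (t * x)) =
        (CLINT x|distr (density \<nu> v) borel X. iexp (t * x))"
      using b eq[of t] by (simp add: integral_distr integral_density)
  qed (use fin M N sets in auto)
  moreover have "(\<integral>x. (indicator A x :: real) \<partial>distr (density \<rho> v) borel X) =
      (\<integral>z. v z * indicator A (X z) \<partial>\<rho>)"
    if [measurable]: "X \<in> borel_measurable \<rho>" "v \<in> borel_measurable \<rho>" for \<rho>
    using b by (subst integral_distr; (subst integral_density)?) auto
  ultimately show ?thesis by (metis \<open>X \<in> borel_measurable \<nu>\<close> \<open>v \<in> borel_measurable \<nu>\<close> X v)
qed

text \<open>
  Reduction to the line. Applying the one-dimensional theorem in the first coordinate needs a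
  nonnegative weight in the second, and \<open>exp (i t z\<^sub>2)\<close> is not one; but \<open>1 + cos (t z\<^sub>2)\<close> and
  \<open>1 + sin (t z\<^sub>2)\<close> are, and both are combinations of exponentials. This determines the
  characteristic function in \<open>z\<^sub>2\<close> of the measure restricted to \<open>z\<^sub>1 \<in> A\<close>, hence the measure of
  every rectangle.
\<close>

lemma mchar_unique_2:
  fixes \<mu> \<nu> :: "(real^2) measure"
  assumes M: "finite_measure \<mu>" "sets \<mu> = sets borel"
    and N: "finite_measure \<nu>" "sets \<nu> = sets borel"
    and eq: "\<And>u. mchar \<mu> u = mchar \<nu> u"
  shows "\<mu> = \<nu>"
proof -
  interpret M: finite_measure \<mu> by fact
  interpret N: finite_measure \<nu> by fact
  have [measurable_cong]: "sets \<mu> = sets borel" "sets \<nu> = sets borel" by fact+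
  have sp: "space \<mu> = UNIV" "space \<nu> = UNIV"
    using M(2) N(2) by (auto dest: sets_eq_imp_space_eq)
  have eq': "(CLINT z|\<mu>. iexp (s * z $ 1 + t * z $ 2)) = (CLINT z|\<nu>. iexp (s * z $ 1 + t * z $ 2))" for s t
    using eq[of "vector [s, t]"] by (simp add: mchar_def inner_2)
  have int: "complex_integrable \<mu> (\<lambda>z. iexp (s * z $ 1 + t * z $ 2))"
     "complex_integrable \<nu> (\<lambda>z. iexp (s * z $ 1 + t * z $ 2))" for s t
    by (auto intro!: M.integrable_const_bound[where B=1] N.integrable_const_bound[where B=1])
  note int' = int[of _ 0, simplified] and eq'' = eq'[of _ 0, simplified]
  have cos: "(\<integral>z. (1 + cos (t * z $ 2)) * indicator A (z $ 1) \<partial>\<mu>) =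
      (\<integral>z. (1 + cos (t * z $ 2)) * indicator A (z $ 1) \<partial>\<nu>)"
    if [measurable]: "A \<in> sets borel" for t A
  proof (rule weighted_marginal_eqI[where K=2])
    fix s
    \<comment> \<open>Euler's formula for the cosine, shifting the frequency in the second coordinate by \<open>t\<close> and \<open>- t\<close>.\<close>
    have *: "(1 + cos (t * z $ 2)) *\<^sub>R iexp (s * z $ 1) =
        iexp (s * z $ 1) + (iexp (s * z $ 1 + t * z $ 2) + iexp (s * z $ 1 + - t * z $ 2)) / 2" for z :: "real^2"
      by (auto simp: complex_eq_iff Re_exp Im_exp algebra_simps cos_add sin_add cos_diff sin_diff simp flip: of_real_mult)
    show "(CLINT z|\<mu>. (1 + cos (t * z $ 2)) *\<^sub>R iexp (s * z $ 1)) =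
        (CLINT z|\<nu>. (1 + cos (t * z $ 2)) *\<^sub>R iexp (s * z $ 1))"
      unfolding * using int[of s t] int[of s "-t"] int'[of s] eq'[of s t] eq'[of s "-t"] eq''[of s]
      by simp
  qed (use that M N in \<open>auto simp: add_nonneg_nonneg intro: order_trans[OF add_left_mono[OF cos_le_one]]\<close>, (smt (verit) cos_ge_minus_one))
  have sin: "(\<integral>z. (1 + sin (t * z $ 2)) * indicator A (z $ 1) \<partial>\<mu>) =
      (\<integral>z. (1 + sin (t * z $ 2)) * indicator A (z $ 1) \<partial>\<nu>)"
    if [measurable]: "A \<in> sets borel" for t A
  proof (rule weighted_marginal_eqI[where K=2])
    fix s
    have *: "(1 + sin (t * z $ 2)) *\<^sub>R iexp (s * z $ 1) =
        iexp (s * z $ 1) + (iexp (s * z $ 1 + t * z $ 2) - iexp (s * z $ 1 + - t * z $ 2)) / (2 * \<i>)" for z :: "real^2"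
      by (auto simp: complex_eq_iff Re_exp Im_exp Re_divide Im_divide algebra_simps cos_add sin_add cos_diff sin_diff power2_eq_square simp flip: of_real_mult)
    show "(CLINT z|\<mu>. (1 + sin (t * z $ 2)) *\<^sub>R iexp (s * z $ 1)) =
        (CLINT z|\<nu>. (1 + sin (t * z $ 2)) *\<^sub>R iexp (s * z $ 1))"
      unfolding * using int[of s t] int[of s "-t"] int'[of s] eq'[of s t] eq'[of s "-t"] eq''[of s]
      by simp
  qed (use that M N in \<open>auto simp: add_nonneg_nonneg intro: order_trans[OF add_left_mono[OF sin_le_one]]\<close>, (smt (verit) sin_ge_minus_one))
  have rect: "(\<integral>z. indicator A (z $ 1) * indicator B (z $ 2) \<partial>\<mu>) =
      (\<integral>z. indicator A (z $ 1) * (indicator B (z $ 2) :: real) \<partial>\<nu>)"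
    if AB[measurable]: "A \<in> sets borel" "B \<in> sets borel" for A B
  proof (rule weighted_marginal_eqI[where K=1])
    fix t
    have i: "integrable \<rho> (\<lambda>z. indicator A (z $ 1) :: real)"
      "integrable \<rho> (\<lambda>z. cos (t * z $ 2) * indicator A (z $ 1))"
      "integrable \<rho> (\<lambda>z. sin (t * z $ 2) * indicator A (z $ 1))"
      if "finite_measure \<rho>" and [measurable_cong]: "sets \<rho> = sets borel" for \<rho> :: "(real^2) measure"
    proof -
      interpret R: finite_measure \<rho> by fact
      show "integrable \<rho> (\<lambda>z. indicator A (z $ 1) :: real)"
        "integrable \<rho> (\<lambda>z. cos (t * z $ 2) * indicator A (z $ 1))"
        "integrable \<rho> (\<lambda>z. sin (t * z $ 2) * indicator A (z $ 1))"
        by (auto intro!: R.integrable_const_bound[where B=1] split: split_indicator)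
    qed
    \<comment> \<open>At \<open>t = 0\<close> the cosine weight is the constant \<open>2\<close>; this allows the constants in the weights to be subtracted.\<close>
    have c0: "(\<integral>z. indicator A (z $ 1) \<partial>\<mu>) = (\<integral>z. (indicator A (z $ 1) :: real) \<partial>\<nu>)"
      using cos[OF AB(1), of 0] by simp
    have cc: "(\<integral>z. cos (t * z $ 2) * indicator A (z $ 1) \<partial>\<mu>) = (\<integral>z. cos (t * z $ 2) * indicator A (z $ 1) \<partial>\<nu>)"
      using cos[OF AB(1), of t] i[OF M] i[OF N] c0 by (simp add: distrib_right)
    have ss: "(\<integral>z. sin (t * z $ 2) * indicator A (z $ 1) \<partial>\<mu>) = (\<integral>z. sin (t * z $ 2) * indicator A (z $ 1) \<partial>\<nu>)"
      using sin[OF AB(1), of t] i[OF M] i[OF N] c0 by (simp add: distrib_right)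
    have *: "indicator A (z $ 1) *\<^sub>R iexp (t * z $ 2) =
       complex_of_real (cos (t * z $ 2) * indicator A (z $ 1)) + \<i> * complex_of_real (sin (t * z $ 2) * indicator A (z $ 1))" for z :: "real^2"
      by (auto simp: complex_eq_iff Re_exp Im_exp  simp flip: of_real_mult)
    show "(CLINT z|\<mu>. indicator A (z $ 1) *\<^sub>R iexp (t * z $ 2)) =
        (CLINT z|\<nu>. indicator A (z $ 1) *\<^sub>R iexp (t * z $ 2))"
      unfolding * using i[OF M] i[OF N] cc ss
      by (simp add: integrable_of_real del: of_real_mult)
  qed (use that M N in \<open>auto split: split_indicator\<close>)
  show ?thesis
  proof (rule measure_eqI_generator_eq)
    let ?E = "range (\<lambda>(a, b). box a b :: (real^2) set)"
    show "Int_stable ?E"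
      by (auto simp: Int_stable_def box_Int_box)
    show "?E \<subseteq> Pow UNIV" "sets \<mu> = sigma_sets UNIV ?E" "sets \<nu> = sigma_sets UNIV ?E"
      using M N by (simp_all add: borel_eq_box)
    let ?A = "\<lambda>n::nat. box (- (real n *\<^sub>R One)) (real n *\<^sub>R One) :: (real^2) set"
    show "range ?A \<subseteq> ?E" "(\<Union>i. ?A i) = UNIV"
      unfolding UN_box_eq_UNIV by auto
    show "emeasure \<mu> (?A i) \<noteq> \<infinity>" for i by simp
    fix X assume "X \<in> ?E"
    then obtain a b where X: "X = box a b" by auto
    have ind: "indicator X z = (indicator {a$1<..<b$1} (z$1) * indicator {a$2<..<b$2} (z$2) :: real)" for z
      by (auto simp: X mem_box_cart forall_2 split: split_indicator)
    have "measure \<mu> X = (\<integral>z. indicator X z \<partial>\<mu>)" "measure \<nu> X = (\<integral>z. indicator X z \<partial>\<nu>)"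
      by (simp_all add: sp)
    then have "measure \<mu> X = measure \<nu> X" unfolding ind using rect by simp
    then show "emeasure \<mu> X = emeasure \<nu> X"
      by (simp add: M.emeasure_eq_measure N.emeasure_eq_measure)
  qed
qed

section \<open>Gaussian laws and their weak convergence\<close>

text \<open>
  Treats the point mass and the proper normal laws uniformly.
\<close>

lemma normal_law_eq_distr:
  assumes "v \<ge> 0"
  shows "normal_law m v = distr std_normal_distribution borel (\<lambda>x. m + sqrt v * x)"
proof (cases "v = 0")
  case True
  interpret prob_space std_normal_distribution by (rule prob_space_normal_density) simp
  have "distr std_normal_distribution borel (\<lambda>_. m) = return borel m"
    by (intro measure_eqI) (auto simp: emeasure_distr emeasure_space_1[simplified] indicator_def split: if_splits)
  with True show ?thesis by (simp add: normal_law_def)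
next
  case False
  then have v: "v > 0" using assms by simp
  interpret prob_space std_normal_distribution by (rule prob_space_normal_density) simp
  have "distributed std_normal_distribution lborel (\<lambda>x. x) std_normal_density"
    by (auto simp: distributed_def distr_id2 cong: distr_cong)
  from normal_density_affine[OF this, of "sqrt v" m] v
  have "distributed std_normal_distribution lborel (\<lambda>x. m + sqrt v * x) (normal_density m (sqrt v))"
    by simp
  then have "distr std_normal_distribution lborel (\<lambda>x. m + sqrt v * x) = density lborel (normal_density m (sqrt v))"
    by (rule distributed_distr_eq_density)
  moreover have "distr std_normal_distribution lborel (\<lambda>x. m + sqrt v * x) =
      distr std_normal_distribution borel (\<lambda>x. m + sqrt v * x)"
    by (intro distr_cong) auto
  ultimately show ?thesis using v by (simp add: normal_law_def)
qed

lemma real_distribution_normal_law: "v \<ge> 0 \<Longrightarrow> real_distribution (normal_law m v)"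
proof -
  interpret prob_space std_normal_distribution by (rule prob_space_normal_density) simp
  show "v \<ge> 0 \<Longrightarrow> real_distribution (normal_law m v)"
    by (simp add: normal_law_eq_distr real_distribution_distr)
qed

lemma char_normal_law:
  assumes "v \<ge> 0"
  shows "char (normal_law m v) s = iexp (s * m) * exp (- v * s\<^sup>2 / 2)"
proof -
  have "char (normal_law m v) s = (CLINT x|std_normal_distribution. iexp (s * m) * iexp (sqrt v * s * x))"
    unfolding normal_law_eq_distr[OF assms] char_def
    by (subst integral_distr) (auto simp: algebra_simps exp_add)
  also have "\<dots> = iexp (s * m) * char std_normal_distribution (sqrt v * s)"
    by (subst integral_mult_right_zero) (simp add: char_def)
  also have "\<dots> = iexp (s * m) * exp (- v * s\<^sup>2 / 2)"
    using assms by (simp add: char_std_normal_distribution power_mult_distrib exp_of_real)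
  finally show ?thesis .
qed

text \<open>
  The characteristic function along the ray through \<open>u\<close> is the characteristic function of the
  projection onto \<open>u\<close>, so that one-dimensional uniqueness applies to every projection.
\<close>

lemma gaussian_iff_mchar:
  assumes "prob_space \<mu>" "sets \<mu> = sets borel" "transpose S = S" "\<And>u. 0 \<le> u \<bullet> (S *v u)"
  shows "gaussian m S \<mu> \<longleftrightarrow> (\<forall>u. mchar \<mu> u = iexp (u \<bullet> m) * exp (- (u \<bullet> (S *v u)) / 2))"
proof
  assume g: "gaussian m S \<mu>"
  show "\<forall>u. mchar \<mu> u = iexp (u \<bullet> m) * exp (- (u \<bullet> (S *v u)) / 2)"
  proof
    fix u
    have "mchar \<mu> u = char (distr \<mu> borel (\<lambda>z. u \<bullet> z)) 1"
      using char_distr_inner[OF assms(2), of u 1] by simp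
    also have "\<dots> = char (normal_law (u \<bullet> m) (u \<bullet> (S *v u))) 1"
      using g by (simp add: gaussian_def)
    finally show "mchar \<mu> u = iexp (u \<bullet> m) * exp (- (u \<bullet> (S *v u)) / 2)"
      using assms(4)[of u] by (simp add: char_normal_law)
  qed
next
  assume eq: "\<forall>u. mchar \<mu> u = iexp (u \<bullet> m) * exp (- (u \<bullet> (S *v u)) / 2)"
  interpret prob_space \<mu> by fact
  have [measurable_cong]: "sets \<mu> = sets borel" by fact
  have "distr \<mu> borel (\<lambda>z. u \<bullet> z) = normal_law (u \<bullet> m) (u \<bullet> (S *v u))" for u
  proof (rule Levy_uniqueness)
    show "real_distribution (distr \<mu> borel (\<lambda>z. u \<bullet> z))"
      by (rule real_distribution_distr) simp
    show "real_distribution (normal_law (u \<bullet> m) (u \<bullet> (S *v u)))"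
      using assms(4) by (rule real_distribution_normal_law)
    show "char (distr \<mu> borel (\<lambda>z. u \<bullet> z)) = char (normal_law (u \<bullet> m) (u \<bullet> (S *v u)))"
      using assms(4)[of u] eq
      by (auto simp: char_distr_inner[OF assms(2)] char_normal_law matrix_vector_mult_scaleR power2_eq_square algebra_simps)
  qed
  then show "gaussian m S \<mu>" using assms by (simp add: gaussian_def)
qed

lemma gaussian_mchar:
  assumes "gaussian m S \<mu>"
  shows "mchar \<mu> u = iexp (u \<bullet> m) * exp (- (u \<bullet> (S *v u)) / 2)"
  using gaussian_iff_mchar[of \<mu> S m] assms by (auto simp: gaussian_def)

lemma gaussian_unique:
  fixes \<mu> \<nu> :: "(real^2) measure"
  assumes "gaussian m S \<mu>" "gaussian m S \<nu>"
  shows "\<mu> = \<nu>"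
proof (rule mchar_unique_2)
  show "mchar \<mu> u = mchar \<nu> u" for u
    using assms[THEN gaussian_mchar] by simp
qed (use assms in \<open>auto simp: gaussian_def prob_space.finite_measure\<close>)

lemma mchar_pair_add:
  fixes f :: "'a \<Rightarrow> 'c::euclidean_space" and g :: "'b \<Rightarrow> 'c"
  assumes "prob_space M" "prob_space N"
    and [measurable]: "f \<in> borel_measurable M" "g \<in> borel_measurable N"
  shows "mchar (distr (M \<Otimes>\<^sub>M N) borel (\<lambda>(x, y). f x + g y)) u =
    (CLINT x|M. iexp (u \<bullet> f x)) * (CLINT y|N. iexp (u \<bullet> g y))"
proof -
  interpret M: prob_space M by fact
  interpret N: prob_space N by fact
  interpret pair_prob_space M N ..
  have "mchar (distr (M \<Otimes>\<^sub>M N) borel (\<lambda>(x, y). f x + g y)) u =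
      (CLINT z|M \<Otimes>\<^sub>M N. iexp (u \<bullet> f (fst z)) * iexp (u \<bullet> g (snd z)))"
    by (subst mchar_distr) (auto simp: case_prod_beta inner_add_right ring_distribs exp_add)
  also have "\<dots> = (CLINT x|M. CLINT y|N. iexp (u \<bullet> f x) * iexp (u \<bullet> g y))"
    by (subst integral_fst'[symmetric])
       (auto intro!: P.integrable_const_bound[where B=1] simp: norm_mult)
  finally show ?thesis by simp
qed

text \<open>
  The columns of the lower triangular Cholesky factor of a planar covariance matrix with positive
  first diagonal entry. They depend continuously on the matrix, also where it becomes singular.
\<close>

definition cholesky1 :: "real^2^2 \<Rightarrow> real^2" where
  "cholesky1 S = vector [sqrt (S$1$1), S$1$2 / sqrt (S$1$1)]"

definition cholesky2 :: "real^2^2 \<Rightarrow> real^2" where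
  "cholesky2 S = vector [0, sqrt (S$2$2 - (S$1$2)\<^sup>2 / S$1$1)]"

definition cholesky_gaussian :: "real^2 \<Rightarrow> real^2^2 \<Rightarrow> (real^2) measure" where
  "cholesky_gaussian m S =
     distr (std_normal_distribution \<Otimes>\<^sub>M std_normal_distribution) borel
       (\<lambda>(x, y). (m + x *\<^sub>R cholesky1 S) + y *\<^sub>R cholesky2 S)"

lemma inner_mult_2:
  "(u::real^2) \<bullet> (S *v u) = u$1 * u$1 * S$1$1 + u$1 * u$2 * (S$1$2 + S$2$1) + u$2 * u$2 * S$2$2"
  by (simp add: inner_2 matrix_vector_mult_def sum_2 algebra_simps)

lemma transpose_2: "transpose (S::real^2^2) = S \<longleftrightarrow> S$1$2 = S$2$1"
  by (auto simp: transpose_def vec_eq_iff forall_2)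

text \<open>
  Completing the square.
\<close>

lemma psd_2:
  assumes "transpose (S::real^2^2) = S" "S$1$1 > 0"
  shows "(\<forall>u. 0 \<le> u \<bullet> (S *v u)) \<longleftrightarrow> (S$1$2)\<^sup>2 \<le> S$1$1 * S$2$2"
proof
  assume "\<forall>u. 0 \<le> u \<bullet> (S *v u)"
  then have "0 \<le> S$1$1 * (S$1$1 * S$2$2 - (S$1$2)\<^sup>2)"
    using assms(1)[unfolded transpose_2]
    by (auto simp: inner_mult_2 power2_eq_square algebra_simps dest!: spec[of _ "vector [- S$1$2, S$1$1] :: real^2"])
  then show "(S$1$2)\<^sup>2 \<le> S$1$1 * S$2$2"
    using assms(2) by (simp add: zero_le_mult_iff)
next
  assume le: "(S$1$2)\<^sup>2 \<le> S$1$1 * S$2$2"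
  show "\<forall>u. 0 \<le> u \<bullet> (S *v u)"
  proof
    fix u :: "real^2"
    have "S$1$1 * (u \<bullet> (S *v u)) = (S$1$1 * u$1 + S$1$2 * u$2)\<^sup>2 + (S$1$1 * S$2$2 - (S$1$2)\<^sup>2) * (u$2)\<^sup>2"
      using assms(1)[unfolded transpose_2] by (simp add: inner_mult_2 power2_eq_square algebra_simps)
    also have "\<dots> \<ge> 0" using le by simp
    finally show "0 \<le> u \<bullet> (S *v u)" using assms(2) by (simp add: zero_le_mult_iff)
  qed
qed

lemma gaussian_cholesky_gaussian:
  fixes S :: "real^2^2"
  assumes sym: "transpose S = S" and pos: "S$1$1 > 0" and le: "(S$1$2)\<^sup>2 \<le> S$1$1 * S$2$2"
  shows "gaussian m S (cholesky_gaussian m S)"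
proof -
  let ?N = std_normal_distribution
  interpret N: prob_space ?N by (rule prob_space_normal_density) simp
  interpret pair_prob_space ?N ?N ..
  have meas[measurable]: "(\<lambda>(x, y). (m + x *\<^sub>R cholesky1 S) + y *\<^sub>R cholesky2 S) \<in> borel_measurable (?N \<Otimes>\<^sub>M ?N)"
    by measurable
  have s: "S$1$2 = S$2$1" using sym by (simp add: transpose_2)
  show ?thesis
  proof (subst gaussian_iff_mchar)
    show "prob_space (cholesky_gaussian m S)"
      unfolding cholesky_gaussian_def by (rule P.prob_space_distr) (rule meas)
    show "sets (cholesky_gaussian m S) = sets borel" by (simp add: cholesky_gaussian_def)
    show "0 \<le> u \<bullet> (S *v u)" for u using psd_2[OF sym pos] le by simp
    show "\<forall>u. mchar (cholesky_gaussian m S) u = iexp (u \<bullet> m) * exp (- (u \<bullet> (S *v u)) / 2)"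
    proof
      fix u
      let ?a = "u \<bullet> cholesky1 S" and ?b = "u \<bullet> cholesky2 S"
      have "0 \<le> S$2$2 - (S$1$2)\<^sup>2 / S$1$1" using le pos by (simp add: field_simps)
      then have b2: "?b\<^sup>2 = (u$2)\<^sup>2 * (S$2$2 - (S$1$2)\<^sup>2 / S$1$1)"
        by (simp add: cholesky2_def inner_2 power_mult_distrib)
      have "?a = (S$1$1 * u$1 + S$1$2 * u$2) / sqrt (S$1$1)"
        using pos by (simp add: cholesky1_def inner_2 field_simps)
      then have a2: "?a\<^sup>2 = (S$1$1 * u$1 + S$1$2 * u$2)\<^sup>2 / S$1$1"
        using pos by (simp add: power_divide)
      have quad: "?a\<^sup>2 + ?b\<^sup>2 = u \<bullet> (S *v u)"
        unfolding a2 b2 using pos s by (simp add: inner_mult_2 field_simps power2_eq_square)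
      have "mchar (cholesky_gaussian m S) u =
          (CLINT x|?N. iexp (u \<bullet> (m + x *\<^sub>R cholesky1 S))) * (CLINT y|?N. iexp (u \<bullet> (y *\<^sub>R cholesky2 S)))"
        unfolding cholesky_gaussian_def by (rule mchar_pair_add) (auto intro: N.prob_space_axioms)
      also have "(CLINT y|?N. iexp (u \<bullet> (y *\<^sub>R cholesky2 S))) = char ?N ?b"
        by (simp add: char_def inner_scaleR_right mult.commute)
      also have "(CLINT x|?N. iexp (u \<bullet> (m + x *\<^sub>R cholesky1 S))) = iexp (u \<bullet> m) * char ?N ?a"
        by (simp add: char_def inner_scaleR_right inner_add_right ring_distribs exp_add mult.commute)
      also have "iexp (u \<bullet> m) * char ?N ?a * char ?N ?b = iexp (u \<bullet> m) * exp (- (?a\<^sup>2 + ?b\<^sup>2) / 2)"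
        by (simp add: char_std_normal_distribution flip: exp_of_real exp_add)
           (simp add: add_divide_distrib diff_divide_distrib algebra_simps)
      finally show "mchar (cholesky_gaussian m S) u = iexp (u \<bullet> m) * exp (- (u \<bullet> (S *v u)) / 2)"
        by (simp only: quad)
    qed
  qed (fact sym)
qed

lemma gaussian_eq_cholesky_gaussian:
  fixes S :: "real^2^2"
  assumes "gaussian m S \<mu>" "S$1$1 > 0"
  shows "\<mu> = cholesky_gaussian m S"
proof (rule gaussian_unique)
  show "gaussian m S (cholesky_gaussian m S)"
    using assms psd_2[of S] by (intro gaussian_cholesky_gaussian) (auto simp: gaussian_def)
qed fact

text \<open>
  All the laws are images of one and the same law on the plane under affine maps whose coefficients
  converge, so that dominated convergence applies. Positivity of \<open>S0$1$1\<close> is enough for the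
  Cholesky factors to converge; the limit itself may be degenerate.
\<close>

lemma gaussian_weakly_converges:
  fixes S :: "real \<Rightarrow> real^2^2"
  assumes N: "\<forall>\<^sub>F t in at_top. gaussian (m t) (S t) (N t)" and \<nu>: "gaussian m0 S0 \<nu>"
    and pos: "S0$1$1 > 0" and m: "(m \<longlongrightarrow> m0) at_top" and S: "(S \<longlongrightarrow> S0) at_top"
  shows "weakly_converges N \<nu> at_top"
  unfolding weakly_converges_def
proof (intro allI impI, elim conjE)
  fix \<phi> :: "real^2 \<Rightarrow> real"
  assume cont: "continuous_on UNIV \<phi>" and "bounded (range \<phi>)"
  then obtain K where K: "\<And>z. \<bar>\<phi> z\<bar> \<le> K" by (auto simp: bounded_iff)
  have [measurable]: "\<phi> \<in> borel_measurable borel" using cont by (rule borel_measurable_continuous_onI)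
  let ?N = std_normal_distribution
  let ?Z = "\<lambda>m S (x, y). (m + x *\<^sub>R cholesky1 S) + y *\<^sub>R cholesky2 S"
  interpret N: prob_space ?N by (rule prob_space_normal_density) simp
  interpret pair_prob_space ?N ?N ..
  have Sij: "((\<lambda>t. S t $ i $ j) \<longlongrightarrow> S0 $ i $ j) at_top" for i j
    by (intro tendsto_vec_nth S)
  have c1: "((\<lambda>t. cholesky1 (S t)) \<longlongrightarrow> cholesky1 S0) at_top"
    by (rule vec_tendstoI, rule forall_2[THEN iffD2, rule_format])
       (use pos in \<open>auto simp: cholesky1_def intro!: tendsto_intros Sij\<close>)
  have c2: "((\<lambda>t. cholesky2 (S t)) \<longlongrightarrow> cholesky2 S0) at_top"
    by (rule vec_tendstoI, rule forall_2[THEN iffD2, rule_format])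
       (use pos in \<open>auto simp: cholesky2_def intro!: tendsto_intros Sij\<close>)
  have lim: "((\<lambda>t. integral\<^sup>L (?N \<Otimes>\<^sub>M ?N) (\<lambda>w. \<phi> (?Z (m t) (S t) w))) \<longlongrightarrow> integral\<^sup>L (?N \<Otimes>\<^sub>M ?N) (\<lambda>w. \<phi> (?Z m0 S0 w))) at_top"
  proof (rule integral_dominated_convergence_at_top[where w="\<lambda>_. K"])
    show "AE w in ?N \<Otimes>\<^sub>M ?N. ((\<lambda>t. \<phi> (?Z (m t) (S t) w)) \<longlongrightarrow> \<phi> (?Z m0 S0 w)) at_top"
      by (intro AE_I2 isCont_tendsto_compose[of _ \<phi>])
         (use cont in \<open>auto simp: continuous_on_eq_continuous_at case_prod_beta intro!: tendsto_intros m c1 c2\<close>)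
  qed (use K in \<open>auto simp: case_prod_beta\<close>)
  have eq: "integral\<^sup>L (cholesky_gaussian m S) \<phi> = integral\<^sup>L (?N \<Otimes>\<^sub>M ?N) (\<lambda>w. \<phi> (?Z m S w))" for m S
    unfolding cholesky_gaussian_def by (subst integral_distr) auto
  have "\<forall>\<^sub>F t in at_top. integral\<^sup>L (?N \<Otimes>\<^sub>M ?N) (\<lambda>w. \<phi> (?Z (m t) (S t) w)) = integral\<^sup>L (N t) \<phi>"
    using N order_tendstoD(1)[OF Sij pos]
    by eventually_elim (metis eq gaussian_eq_cholesky_gaussian)
  with lim have "((\<lambda>t. integral\<^sup>L (N t) \<phi>) \<longlongrightarrow> integral\<^sup>L (?N \<Otimes>\<^sub>M ?N) (\<lambda>w. \<phi> (?Z m0 S0 w))) at_top"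
    by (rule Lim_transform_eventually)
  then show "((\<lambda>t. integral\<^sup>L (N t) \<phi>) \<longlongrightarrow> integral\<^sup>L \<nu> \<phi>) at_top"
    using gaussian_eq_cholesky_gaussian[OF \<nu> pos] by (simp add: eq)
qed

lemma vector_2_eq: "(vector [x, y] :: real^2) = x *\<^sub>R axis 1 1 + y *\<^sub>R axis 2 1"
  by (simp add: vec_eq_iff forall_2 axis_def)

lemma normal_law_inject:
  assumes "normal_law m v = normal_law m' v'" "v \<ge> 0" "v' \<ge> 0"
  shows "v = v'"
proof -
  have "exp (- v / 2) = exp (- v' / 2)"
    using arg_cong[OF assms(1), of "\<lambda>M. norm (char M 1)"]
    unfolding char_normal_law[OF assms(2)] char_normal_law[OF assms(3)] by (simp add: norm_mult)
  then show ?thesis by simp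
qed

lemma gibbs_measure_quadratic:
  assumes "v > 0"
  shows "gibbs_measure (\<lambda>x. x\<^sup>2 / (2 * v)) = normal_law 0 v"
proof -
  have *: "exp (- (x\<^sup>2 / (2 * v))) = sqrt (2 * pi * v) * normal_density 0 (sqrt v) x" for x
    using assms by (simp add: normal_density_def)
  have "(LINT x|lborel. exp (- (x\<^sup>2 / (2 * v)))) = sqrt (2 * pi * v)"
    unfolding * using assms by simp
  then have "exp (- (x\<^sup>2 / (2 * v))) / (LINT x|lborel. exp (- (x\<^sup>2 / (2 * v)))) = normal_density 0 (sqrt v) x" for x
    using assms *[of x] by simp
  then show ?thesis using assms by (simp add: gibbs_measure_def normal_law_def)
qed

lemma gaussian_graph:
  fixes a v :: real
  assumes "v \<ge> 0"
  shows "gaussian 0 (v *\<^sub>R vector [vector [1, a], vector [a, a\<^sup>2]] :: real^2^2) (distr (normal_law 0 v) borel (\<lambda>x. vector [x, a * x]))"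
    (is "gaussian 0 ?S (distr ?\<mu> borel ?g)")
proof (subst gaussian_iff_mchar)
  interpret real_distribution ?\<mu> using assms by (rule real_distribution_normal_law)
  have gm: "?g \<in> borel_measurable ?\<mu>" unfolding vector_2_eq by measurable
  show "prob_space (distr ?\<mu> borel ?g)" using gm by (rule prob_space_distr)
  show "transpose ?S = ?S" by (simp add: transpose_2)
  have quad: "u \<bullet> (?S *v u) = v * (u$1 + a * u$2)\<^sup>2" for u
    by (simp add: inner_mult_2 power2_eq_square algebra_simps)
  show "0 \<le> u \<bullet> (?S *v u)" for u unfolding quad using assms by simp
  show "\<forall>u. mchar (distr ?\<mu> borel ?g) u = iexp (u \<bullet> 0) * exp (- (u \<bullet> (?S *v u)) / 2)"
  proof
    fix u :: "real^2"
    have "mchar (distr ?\<mu> borel ?g) u = char ?\<mu> (u$1 + a * u$2)"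
      unfolding char_def mchar_distr[OF gm] by (simp add: inner_2 algebra_simps)
    then show "mchar (distr ?\<mu> borel ?g) u = iexp (u \<bullet> 0) * exp (- (u \<bullet> (?S *v u)) / 2)"
      unfolding quad using assms by (simp add: char_normal_law)
  qed
qed simp

section \<open>The characteristic function of a solution\<close>

text \<open>
  The mean value inequality for \<open>x \<mapsto> f x - x f'(s)\<close> with a modulus of uniform continuity of \<open>f'\<close>.
\<close>

lemma uniform_vector_derivative:
  fixes f :: "real \<Rightarrow> 'a::real_normed_vector"
  assumes der: "\<And>s. s \<in> {0..t} \<Longrightarrow> (f has_vector_derivative f' s) (at s within {0..t})"
    and cont: "continuous_on {0..t} f'" and e: "e > 0"
  obtains d where "d > 0"
    "\<And>s r. s \<in> {0..t} \<Longrightarrow> r \<in> {0..t} \<Longrightarrow> \<bar>r - s\<bar> < d \<Longrightarrow> norm (f r - f s - (r - s) *\<^sub>R f' s) \<le> e * \<bar>r - s\<bar>"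
proof -
  have "uniformly_continuous_on {0..t} f'"
    using cont by (rule compact_uniformly_continuous) simp
  then obtain d where d: "d > 0" "\<And>x y. x \<in> {0..t} \<Longrightarrow> y \<in> {0..t} \<Longrightarrow> dist x y < d \<Longrightarrow> dist (f' x) (f' y) < e"
    using e unfolding uniformly_continuous_on_def by metis
  show thesis
  proof (rule that[OF d(1)])
    fix s r assume s: "s \<in> {0..t}" and r: "r \<in> {0..t}" and rs: "\<bar>r - s\<bar> < d"
    let ?X = "{0..t} \<inter> ball s d"
    have "norm ((f r - r *\<^sub>R f' s) - (f s - s *\<^sub>R f' s)) \<le> e * norm (r - s)"
    proof (rule differentiable_bound[where f'="\<lambda>x h. h *\<^sub>R (f' x - f' s)"])
      show "convex ?X" by (intro convex_Int) auto
      fix x assume x: "x \<in> ?X"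
      have "(f has_vector_derivative f' x) (at x within ?X)"
        using der[of x] x by (auto intro: has_vector_derivative_within_subset)
      then have "((\<lambda>x. f x - x *\<^sub>R f' s) has_vector_derivative f' x - f' s) (at x within ?X)"
        by (auto intro!: derivative_eq_intros)
      then show "((\<lambda>x. f x - x *\<^sub>R f' s) has_derivative (\<lambda>h. h *\<^sub>R (f' x - f' s))) (at x within ?X)"
        by (simp add: has_vector_derivative_def)
      have "norm (f' x - f' s) \<le> e"
        using d(2)[of x s] x s by (auto simp: dist_norm norm_minus_commute abs_minus_commute)
      then show "onorm (\<lambda>h. h *\<^sub>R (f' x - f' s)) \<le> e"
        using e by (intro onorm_bound) (auto simp: mult.commute[of e] intro: mult_left_mono)
    qed (use s r rs d in \<open>auto simp: dist_norm\<close>)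
    then show "norm (f r - f s - (r - s) *\<^sub>R f' s) \<le> e * \<bar>r - s\<bar>"
      by (simp add: algebra_simps)
  qed
qed

definition grid :: "real \<Rightarrow> nat \<Rightarrow> nat \<Rightarrow> real" where
  "grid t N j = t * real j / real N"

text \<open>
  Errors that are \<open>o(r - s)\<close> uniformly over the subintervals \<open>[s, r]\<close> add up to \<open>o(1)\<close>.
\<close>

lemma sum_over_grid_tendsto_0:
  fixes G :: "real \<Rightarrow> real \<Rightarrow> 'a::real_normed_vector"
  assumes t: "t \<ge> 0"
    and G: "\<And>e. e > 0 \<Longrightarrow> \<exists>d>0. \<forall>s r. 0 \<le> s \<longrightarrow> s \<le> r \<longrightarrow> r \<le> t \<longrightarrow> r - s < d \<longrightarrow> norm (G s r) \<le> e * (r - s)"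
  shows "(\<lambda>N. \<Sum>j<N. G (grid t N j) (grid t N (Suc j))) \<longlonglongrightarrow> 0"
proof (rule LIMSEQ_I)
  fix e :: real assume e: "e > 0"
  define e' where "e' = e / (t + 1)"
  have e': "e' > 0" "e' * t < e" using e t by (auto simp: e'_def field_simps)
  from G[OF e'(1)] obtain d where d: "d > 0"
    "\<And>s r. 0 \<le> s \<Longrightarrow> s \<le> r \<Longrightarrow> r \<le> t \<Longrightarrow> r - s < d \<Longrightarrow> norm (G s r) \<le> e' * (r - s)" by auto
  obtain N0 :: nat where N0: "t / d < real N0" using reals_Archimedean2 by blast
  have "norm (\<Sum>j<N. G (grid t N j) (grid t N (Suc j))) < e" if N: "N \<ge> Suc N0" for N
  proof -
    have N': "N > 0" "t / d < real N" using N N0 by (auto intro: less_le_trans[of "t/d" N0])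
    have step: "grid t N (Suc j) - grid t N j = t / N" for j
      using N' by (simp add: grid_def field_simps)
    have "norm (\<Sum>j<N. G (grid t N j) (grid t N (Suc j))) \<le> (\<Sum>j<N. e' * (t / N))"
    proof (rule sum_norm_le)
      fix j assume j: "j \<in> {..<N}"
      have "norm (G (grid t N j) (grid t N (Suc j))) \<le> e' * (grid t N (Suc j) - grid t N j)"
      proof (rule d(2))
        show "0 \<le> grid t N j" "grid t N j \<le> grid t N (Suc j)"
          using t by (auto simp: grid_def intro!: divide_right_mono mult_left_mono)
        have "t * real (Suc j) \<le> t * real N" using j t by (intro mult_left_mono) auto
        then show "grid t N (Suc j) \<le> t" using N' by (simp add: grid_def divide_le_eq)
        have "t / N < d" using N' d by (simp add: field_simps)
        then show "grid t N (Suc j) - grid t N j < d" by (simp add: step)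
      qed
      then show "norm (G (grid t N j) (grid t N (Suc j))) \<le> e' * (t / N)" by (simp add: step)
    qed
    also have "\<dots> = e' * t" using N' by simp
    finally show ?thesis using e' by linarith
  qed
  then show "\<exists>N0. \<forall>N\<ge>N0. norm ((\<Sum>j<N. G (grid t N j) (grid t N (Suc j))) - 0) < e" by auto
qed

lemma riemann_sum_tendsto:
  fixes F :: "real \<Rightarrow> real"
  assumes t: "t \<ge> 0"
    and der: "\<And>s. s \<in> {0..t} \<Longrightarrow> (F has_real_derivative f s) (at s within {0..t})"
    and cont: "continuous_on {0..t} f"
  shows "(\<lambda>N. \<Sum>j<N. f (grid t N j) * (grid t N (Suc j) - grid t N j)) \<longlonglongrightarrow> F t - F 0"
proof -
  have lim: "(\<lambda>N. \<Sum>j<N. F (grid t N (Suc j)) - F (grid t N j) - f (grid t N j) * (grid t N (Suc j) - grid t N j)) \<longlonglongrightarrow> 0"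
  proof (rule sum_over_grid_tendsto_0[OF t])
    fix e :: real assume "e > 0"
    from uniform_vector_derivative[of t F f e] this der cont
    obtain d where d: "d > 0" "\<And>s r. s \<in> {0..t} \<Longrightarrow> r \<in> {0..t} \<Longrightarrow> \<bar>r - s\<bar> < d \<Longrightarrow> norm (F r - F s - (r - s) *\<^sub>R f s) \<le> e * \<bar>r - s\<bar>"
      by (auto simp: has_real_derivative_iff_has_vector_derivative)
    have "norm (F r - F s - f s * (r - s)) \<le> e * (r - s)" if "0 \<le> s" "s \<le> r" "r \<le> t" "r - s < d" for s r
      using that d(2)[of s r] by (simp add: mult.commute)
    then show "\<exists>d>0. \<forall>s r. 0 \<le> s \<longrightarrow> s \<le> r \<longrightarrow> r \<le> t \<longrightarrow> r - s < d \<longrightarrow> norm (F r - F s - f s * (r - s)) \<le> e * (r - s)"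
      using d(1) by blast
  qed
  have eq: "(\<Sum>j<N. F (grid t N (Suc j)) - F (grid t N j) - f (grid t N j) * (grid t N (Suc j) - grid t N j)) =
      F t - F 0 - (\<Sum>j<N. f (grid t N j) * (grid t N (Suc j) - grid t N j))" if "N > 0" for N
    using that sum_lessThan_telescope[of "\<lambda>j. F (grid t N j)" N]
    by (simp add: sum_subtractf) (simp add: grid_def)
  have "(\<lambda>N. F t - F 0 - (\<Sum>j<N. f (grid t N j) * (grid t N (Suc j) - grid t N j))) \<longlonglongrightarrow> 0"
    by (rule Lim_transform_eventually[OF lim eventually_mono[OF eventually_gt_at_top[of 0] eq]])
  from tendsto_diff[OF tendsto_const[of "F t - F 0"] this] show ?thesis by simp
qed

text \<open>
  A deterministic statement about a single path, which replaces stochastic integration: the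
  integrand \<open>a \<bullet> B\<close> is smooth and deterministic, so that the limit exists path by path. On \<open>[s, r]\<close> the
  increment of \<open>a \<bullet> Z\<close> differs from \<open>(a s \<bullet> B) (W r - W s)\<close> by \<open>o(r - s)\<close>: the first-order terms
  \<open>(r - s) A\<^sup>T a s \<bullet> Z r\<close>, from the change of \<open>a\<close>, and \<open>- (r - s) a s \<bullet> A Z r\<close>, from the drift, cancel.
\<close>

lemma stochastic_riemann_sum_tendsto:
  fixes a Z :: "real \<Rightarrow> real^'n" and W :: "real \<Rightarrow> real" and A :: "real^'n^'n"
  assumes t: "t \<ge> 0"
    and a: "\<And>s. s \<in> {0..t} \<Longrightarrow> (a has_vector_derivative transpose A *v a s) (at s within {0..t})"
    and Z: "continuous_on {0..t} Z"
    and eq: "\<And>s. s \<in> {0..t} \<Longrightarrow> Z s = Z 0 + integral {0..s} (\<lambda>s. - (A *v Z s)) + W s *\<^sub>R B"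
  shows "(\<lambda>N. \<Sum>j<N. (a (grid t N j) \<bullet> B) * (W (grid t N (Suc j)) - W (grid t N j))) \<longlonglongrightarrow> a t \<bullet> Z t - a 0 \<bullet> Z 0"
proof -
  define V where "V s = integral {0..s} (\<lambda>s. - (A *v Z s))" for s
  have contAZ: "continuous_on {0..t} (\<lambda>s. - (A *v Z s))"
    by (intro continuous_on_minus bounded_linear.continuous_on[OF matrix_vector_mul_bounded_linear] Z)
  have V: "(V has_vector_derivative - (A *v Z s)) (at s within {0..t})" if "s \<in> {0..t}" for s
    unfolding V_def using integral_has_vector_derivative[OF contAZ that] .
  have conta: "continuous_on {0..t} a"
    unfolding continuous_on_eq_continuous_within using a by (blast intro: has_vector_derivative_continuous)
  obtain KZ where KZ: "KZ > 0" "\<And>s. s \<in> {0..t} \<Longrightarrow> norm (Z s) \<le> KZ"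
    using compact_imp_bounded[OF compact_continuous_image[OF Z]] by (auto simp: bounded_pos)
  obtain Ka where Ka: "Ka > 0" "\<And>s. s \<in> {0..t} \<Longrightarrow> norm (a s) \<le> Ka"
    using compact_imp_bounded[OF compact_continuous_image[OF conta]] by (auto simp: bounded_pos)
  let ?G = "\<lambda>s r. a r \<bullet> Z r - a s \<bullet> Z s - (a s \<bullet> B) * (W r - W s)"
  have lim: "(\<lambda>N. \<Sum>j<N. ?G (grid t N j) (grid t N (Suc j))) \<longlonglongrightarrow> 0"
  proof (rule sum_over_grid_tendsto_0[OF t])
    fix e :: real assume e: "e > 0"
    obtain d1 where d1: "d1 > 0" "\<And>s r. s \<in> {0..t} \<Longrightarrow> r \<in> {0..t} \<Longrightarrow> \<bar>r - s\<bar> < d1 \<Longrightarrow>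
        norm (a r - a s - (r - s) *\<^sub>R (transpose A *v a s)) \<le> (e / (2 * KZ)) * \<bar>r - s\<bar>"
      by (rule uniform_vector_derivative[OF a bounded_linear.continuous_on[OF matrix_vector_mul_bounded_linear conta], of "e / (2 * KZ)"])
         (use e KZ in auto)
    obtain d2 where d2: "d2 > 0" "\<And>s r. s \<in> {0..t} \<Longrightarrow> r \<in> {0..t} \<Longrightarrow> \<bar>r - s\<bar> < d2 \<Longrightarrow>
        norm (V r - V s - (r - s) *\<^sub>R (- (A *v Z s))) \<le> (e / (2 * Ka)) * \<bar>r - s\<bar>"
      by (rule uniform_vector_derivative[of t V "\<lambda>s. - (A *v Z s)" "e / (2 * Ka)"])
         (use V e Ka contAZ in auto)
    have "norm (?G s r) \<le> e * (r - s)" if sr: "0 \<le> s" "s \<le> r" "r \<le> t" "r - s < min d1 d2" for s r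
    proof -
      have s: "s \<in> {0..t}" and r: "r \<in> {0..t}" using sr by auto
      \<comment> \<open>\<open>?x\<close> is the Taylor remainder of \<open>a\<close> at \<open>s\<close>, and \<open>?y\<close> that of the drift integral \<open>V\<close> at \<open>r\<close>.\<close>
      let ?x = "a r - a s - (r - s) *\<^sub>R (transpose A *v a s)"
      let ?y = "V s - V r - (s - r) *\<^sub>R (- (A *v Z r))"
      have "Z r - Z s = V r - V s + (W r - W s) *\<^sub>R B"
        using eq[OF r] eq[OF s] by (simp add: V_def algebra_simps)
      then have "a s \<bullet> (Z r - Z s) = a s \<bullet> (V r - V s) + (W r - W s) * (a s \<bullet> B)"
        by (simp add: inner_add_right)
      moreover have "(transpose A *v a s) \<bullet> Z r = a s \<bullet> (A *v Z r)"
        by (simp add: dot_lmul_matrix[symmetric])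
      ultimately have "?G s r = ?x \<bullet> Z r - a s \<bullet> ?y"
        by (simp add: algebra_simps inner_diff_left inner_diff_right inner_add_right inner_add_left)
      also have "norm \<dots> \<le> norm ?x * norm (Z r) + norm (a s) * norm ?y"
        using norm_triangle_ineq4[of "?x \<bullet> Z r" "a s \<bullet> ?y"] Cauchy_Schwarz_ineq2[of ?x "Z r"] Cauchy_Schwarz_ineq2[of "a s" ?y]
        by simp
      also have "\<dots> \<le> (e / (2 * KZ) * \<bar>r - s\<bar>) * KZ + Ka * (e / (2 * Ka) * \<bar>s - r\<bar>)"
        using d1(2)[OF s r] d2(2)[OF r s] sr KZ Ka s r e
        by (intro add_mono mult_mono) auto
      also have "\<dots> = e * (r - s)" using KZ Ka sr by (simp add: field_simps)
      finally show ?thesis .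
    qed
    then show "\<exists>d>0. \<forall>s r. 0 \<le> s \<longrightarrow> s \<le> r \<longrightarrow> r \<le> t \<longrightarrow> r - s < d \<longrightarrow> norm (?G s r) \<le> e * (r - s)"
      using d1 d2 by (intro exI[of _ "min d1 d2"]) auto
  qed
  have eq': "(\<Sum>j<N. ?G (grid t N j) (grid t N (Suc j))) =
      a t \<bullet> Z t - a 0 \<bullet> Z 0 - (\<Sum>j<N. (a (grid t N j) \<bullet> B) * (W (grid t N (Suc j)) - W (grid t N j)))" if "N > 0" for N
    using that sum_lessThan_telescope[of "\<lambda>j. a (grid t N j) \<bullet> Z (grid t N j)" N]
    by (simp add: sum_subtractf) (simp add: grid_def)
  have "(\<lambda>N. a t \<bullet> Z t - a 0 \<bullet> Z 0 - (\<Sum>j<N. (a (grid t N j) \<bullet> B) * (W (grid t N (Suc j)) - W (grid t N j)))) \<longlonglongrightarrow> 0"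
    by (rule Lim_transform_eventually[OF lim eventually_mono[OF eventually_gt_at_top[of 0] eq']])
  from tendsto_diff[OF tendsto_const[of "a t \<bullet> Z t - a 0 \<bullet> Z 0"] this] show ?thesis by simp
qed

text \<open>
  The increment is independent of the past, and centred normal with variance \<open>r - s\<close>.
\<close>

lemma brownian_increment_char:
  assumes W: "brownian_motion M F W" and s: "0 \<le> s" "s < r" and X: "X \<in> borel_measurable (F s)"
  shows "(CLINT \<omega>|M. iexp (X \<omega> + c * (W r \<omega> - W s \<omega>))) = (CLINT \<omega>|M. iexp (X \<omega>)) * exp (- c\<^sup>2 * (r - s) / 2)"
proof -
  interpret prob_space M using W by (simp add: brownian_motion_def)
  have sub: "subalgebra M (F s)" "subalgebra M (F r)" using W s by (auto simp: brownian_motion_def)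
  have Wm: "W s \<in> borel_measurable M" "W r \<in> borel_measurable M"
    using W s by (auto simp: brownian_motion_def
        intro: measurable_from_subalg[OF sub(1)] measurable_from_subalg[OF sub(2)])
  have Xm[measurable]: "X \<in> borel_measurable M" using X sub(1) by (rule measurable_from_subalg[rotated])
  let ?D = "\<lambda>\<omega>. W r \<omega> - W s \<omega>"
  have Dm[measurable]: "?D \<in> borel_measurable M" using Wm by simp
  have ind: "indep_set (sets (F s)) (sets (vimage_algebra (space M) ?D borel))"
    and law: "distr M borel ?D = normal_law 0 (r - s)"
    using W s by (auto simp: brownian_motion_def)
  have "indep_var borel X borel ?D"
    unfolding indep_var_eq
  proof (intro conjI)
    have "X -` A \<inter> space M \<in> sets (F s)" if "A \<in> sets borel" for A
      using measurable_sets[OF X that] sub(1) by (simp add: subalgebra_def)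
    then have 1: "sigma_sets (space M) {X -` A \<inter> space M |A. A \<in> sets borel} \<subseteq> sets (F s)"
      using sub(1) sets.sigma_sets_subset[of "{X -` A \<inter> space M |A. A \<in> sets borel}" "F s"]
      by (auto simp: subalgebra_def)
    have 2: "sigma_sets (space M) {?D -` A \<inter> space M |A. A \<in> sets borel} = sets (vimage_algebra (space M) ?D borel)"
      by (simp add: sets_vimage_algebra)
    show "indep_set (sigma_sets (space M) {X -` A \<inter> space M |A. A \<in> sets borel})
        (sigma_sets (space M) {?D -` A \<inter> space M |A. A \<in> sets borel})"
      using ind 1 unfolding 2 indep_sets2_eq by blast
  qed auto
  then have "indep_var borel X borel (\<lambda>\<omega>. c * ?D \<omega>)"
    using indep_var_compose[of borel X borel ?D "\<lambda>x. x" borel "\<lambda>x. c * x" borel] by (simp add: comp_def)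
  from char_distr_add[OF this, of 1]
  have "(CLINT \<omega>|M. iexp (X \<omega> + c * ?D \<omega>)) = (CLINT \<omega>|M. iexp (X \<omega>)) * (CLINT \<omega>|M. iexp (c * ?D \<omega>))"
    by (simp add: char_def integral_distr)
  also have "(CLINT \<omega>|M. iexp (c * ?D \<omega>)) = char (distr M borel ?D) c"
    unfolding char_def by (subst integral_distr) auto
  also have "\<dots> = exp (- c\<^sup>2 * (r - s) / 2)"
    unfolding law using s by (simp add: char_normal_law exp_of_real algebra_simps)
  finally show ?thesis .
qed

lemma brownian_sum_char:
  assumes W: "brownian_motion M F W" and X: "X \<in> borel_measurable (F 0)"
    and \<tau>: "\<tau> 0 = 0" "strict_mono \<tau>"
  shows "(CLINT \<omega>|M. iexp (X \<omega> + (\<Sum>j<n. c j * (W (\<tau> (Suc j)) \<omega> - W (\<tau> j) \<omega>)))) =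
    (CLINT \<omega>|M. iexp (X \<omega>)) * exp (- (\<Sum>j<n. (c j)\<^sup>2 * (\<tau> (Suc j) - \<tau> j)) / 2)"
proof (induction n)
  case 0
  show ?case by simp
next
  case (Suc n)
  have \<tau>0: "0 \<le> \<tau> j" for j using \<tau> strict_mono_less_eq[OF \<tau>(2), of 0 j] by simp
  have meas: "f \<in> borel_measurable (F (\<tau> n))" if "f \<in> borel_measurable (F (\<tau> j))" "j \<le> n" for j and f :: "_ \<Rightarrow> real"
  proof -
    have "subalgebra (F (\<tau> n)) (F (\<tau> j))"
      using W \<tau>0[of j] strict_mono_less_eq[OF \<tau>(2), of j n] that(2) by (auto simp: brownian_motion_def)
    then show ?thesis using that(1) by (rule measurable_from_subalg)
  qed
  have Wm: "W (\<tau> j) \<in> borel_measurable (F (\<tau> n))" if "j \<le> n" for j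
    by (rule meas[OF _ that]) (use W \<tau>0 in \<open>auto simp: brownian_motion_def\<close>)
  have "X \<in> borel_measurable (F (\<tau> n))" using meas[of X 0] X \<tau> by simp
  then have m: "(\<lambda>\<omega>. X \<omega> + (\<Sum>j<n. c j * (W (\<tau> (Suc j)) \<omega> - W (\<tau> j) \<omega>))) \<in> borel_measurable (F (\<tau> n))"
    by (intro borel_measurable_add borel_measurable_sum borel_measurable_times borel_measurable_diff borel_measurable_const Wm) auto
  have "\<tau> n < \<tau> (Suc n)" using strict_monoD[OF \<tau>(2), of n "Suc n"] by simp
  from brownian_increment_char[OF W \<tau>0[of n] this m, of "c n"] Suc.IH
  have "(CLINT \<omega>|M. iexp (X \<omega> + (\<Sum>j<Suc n. c j * (W (\<tau> (Suc j)) \<omega> - W (\<tau> j) \<omega>)))) =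
      (CLINT \<omega>|M. iexp (X \<omega>)) * (exp (- (\<Sum>j<n. (c j)\<^sup>2 * (\<tau> (Suc j) - \<tau> j)) / 2) *
        exp (- (c n)\<^sup>2 * (\<tau> (Suc n) - \<tau> n) / 2))"
    by (simp only: sum.lessThan_Suc add.assoc mult.assoc of_real_mult)
  also have "exp (- (\<Sum>j<n. (c j)\<^sup>2 * (\<tau> (Suc j) - \<tau> j)) / 2) *
        exp (- (c n)\<^sup>2 * (\<tau> (Suc n) - \<tau> n) / 2) = exp (- (\<Sum>j<Suc n. (c j)\<^sup>2 * (\<tau> (Suc j) - \<tau> j)) / 2)"
    by (simp add: diff_divide_distrib flip: exp_add)
  finally show ?case by simp
qed

text \<open>
  Passes to the limit in \<open>brownian_sum_char\<close> for Riemann sums on finer and finer grids. The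
  exponents converge to the increment of an antiderivative \<open>Q\<close> of \<open>(a \<bullet> B)\<^sup>2\<close>; having \<open>Q\<close> as a
  parameter avoids integrals, and it will be given in closed form by the Lyapunov equation.
\<close>

lemma linear_sde_mchar:
  fixes a :: "real \<Rightarrow> real^'n"
  assumes sol: "linear_sde_solution A B M F W Z" and t: "t > 0"
    and a: "\<And>s. s \<in> {0..t} \<Longrightarrow> (a has_vector_derivative transpose A *v a s) (at s within {0..t})"
    and Q: "\<And>s. s \<in> {0..t} \<Longrightarrow> (Q has_real_derivative (a s \<bullet> B)\<^sup>2) (at s within {0..t})"
  shows "mchar (distr M borel (Z t)) (a t) = mchar (distr M borel (Z 0)) (a 0) * exp (- (Q t - Q 0) / 2)"
proof -
  have W: "brownian_motion M F W" using sol by (simp add: linear_sde_solution_def)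
  interpret prob_space M using W by (simp add: brownian_motion_def)
  have Fm: "X \<in> borel_measurable M" if "s \<ge> 0" "X \<in> borel_measurable (F s)" for s and X :: "_ \<Rightarrow> 'z::topological_space"
    using W that by (auto simp: brownian_motion_def intro: measurable_from_subalg)
  have ZF: "Z s \<in> borel_measurable (F s)" if "s \<ge> 0" for s using sol that by (simp add: linear_sde_solution_def)
  have Zm[measurable]: "Z 0 \<in> borel_measurable M" "Z t \<in> borel_measurable M" using t by (auto intro: Fm[OF _ ZF])
  have Wm: "W s \<in> borel_measurable M" if "s \<ge> 0" for s
    using W that by (intro Fm[OF that]) (simp add: brownian_motion_def)
  have g0: "grid t N j \<ge> 0" for N j using t by (simp add: grid_def)
  have conta: "continuous_on {0..t} a"
    unfolding continuous_on_eq_continuous_within using a by (blast intro: has_vector_derivative_continuous)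
  let ?S = "\<lambda>N \<omega>. \<Sum>j<N. (a (grid t N j) \<bullet> B) * (W (grid t N (Suc j)) \<omega> - W (grid t N j) \<omega>)"
  have Sm[measurable]: "?S N \<in> borel_measurable M" for N
    by (intro borel_measurable_sum borel_measurable_times borel_measurable_diff borel_measurable_const Wm g0)
  have lim1: "(\<lambda>N. CLINT \<omega>|M. iexp (a 0 \<bullet> Z 0 \<omega> + ?S N \<omega>)) \<longlonglongrightarrow> (CLINT \<omega>|M. iexp (a t \<bullet> Z t \<omega>))"
  proof (rule integral_dominated_convergence[where w="\<lambda>_. 1"])
    have "AE \<omega> in M. continuous_on {0..} (\<lambda>t. Z t \<omega>)"
      "AE \<omega> in M. \<forall>t\<ge>0. Z t \<omega> = Z 0 \<omega> + integral {0..t} (\<lambda>s. - (A *v Z s \<omega>)) + W t \<omega> *\<^sub>R B"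
      using sol by (auto simp: linear_sde_solution_def)
    then show "AE \<omega> in M. (\<lambda>N. iexp (a 0 \<bullet> Z 0 \<omega> + ?S N \<omega>)) \<longlonglongrightarrow> iexp (a t \<bullet> Z t \<omega>)"
    proof eventually_elim
      case (elim \<omega>)
      have "(\<lambda>N. ?S N \<omega>) \<longlonglongrightarrow> a t \<bullet> Z t \<omega> - a 0 \<bullet> Z 0 \<omega>"
      proof (rule stochastic_riemann_sum_tendsto)
        show "continuous_on {0..t} (\<lambda>s. Z s \<omega>)"
          by (rule continuous_on_subset[OF elim(1)]) auto
        show "Z s \<omega> = Z 0 \<omega> + integral {0..s} (\<lambda>s. - (A *v Z s \<omega>)) + W s \<omega> *\<^sub>R B" if "s \<in> {0..t}" for s
          by (rule elim(2)[rule_format]) (use that in simp)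
      qed (use t a in simp_all)
      from tendsto_add[OF tendsto_const[of "a 0 \<bullet> Z 0 \<omega>"] this]
      have "(\<lambda>N. a 0 \<bullet> Z 0 \<omega> + ?S N \<omega>) \<longlonglongrightarrow> a t \<bullet> Z t \<omega>" by simp
      then show ?case by (intro isCont_tendsto_compose[of _ iexp]) auto
    qed
    show "(\<lambda>\<omega>. iexp (a 0 \<bullet> Z 0 \<omega> + ?S N \<omega>)) \<in> borel_measurable M" for N
      by measurable
  qed simp_all
  have "(\<lambda>N. \<Sum>j<N. (a (grid t N j) \<bullet> B)\<^sup>2 * (grid t N (Suc j) - grid t N j)) \<longlonglongrightarrow> Q t - Q 0"
    by (rule riemann_sum_tendsto) (use t Q conta in \<open>auto intro!: continuous_intros\<close>)
  then have lim: "(\<lambda>N. (CLINT \<omega>|M. iexp (a 0 \<bullet> Z 0 \<omega>)) *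
        complex_of_real (exp (- (\<Sum>j<N. (a (grid t N j) \<bullet> B)\<^sup>2 * (grid t N (Suc j) - grid t N j)) / 2)))
      \<longlonglongrightarrow> (CLINT \<omega>|M. iexp (a 0 \<bullet> Z 0 \<omega>)) * complex_of_real (exp (- (Q t - Q 0) / 2))"
    by (intro tendsto_intros) auto
  have eq: "(CLINT \<omega>|M. iexp (a 0 \<bullet> Z 0 \<omega>)) *
        complex_of_real (exp (- (\<Sum>j<N. (a (grid t N j) \<bullet> B)\<^sup>2 * (grid t N (Suc j) - grid t N j)) / 2)) =
      (CLINT \<omega>|M. iexp (a 0 \<bullet> Z 0 \<omega> + ?S N \<omega>))" if "N > 0" for N
  proof -
    have "(\<lambda>\<omega>. a 0 \<bullet> Z 0 \<omega>) \<in> borel_measurable (F 0)"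
      using ZF[of 0] by simp
    moreover have "grid t N 0 = 0" "strict_mono (grid t N)"
      using that t by (auto simp: grid_def strict_mono_def divide_strict_right_mono)
    ultimately show ?thesis
      by (rule brownian_sum_char[OF W, symmetric])
  qed
  have "(\<lambda>N. CLINT \<omega>|M. iexp (a 0 \<bullet> Z 0 \<omega> + ?S N \<omega>))
      \<longlonglongrightarrow> (CLINT \<omega>|M. iexp (a 0 \<bullet> Z 0 \<omega>)) * complex_of_real (exp (- (Q t - Q 0) / 2))"
    by (rule Lim_transform_eventually[OF lim eventually_mono[OF eventually_gt_at_top[of 0] eq]])
  from LIMSEQ_unique[OF lim1 this] show ?thesis
    by (simp add: mchar_distr)
qed

section \<open>The flow of the drift and the transition covariance\<close>

text \<open>
  \<open>C\<close> and \<open>S\<close> are \<open>cosh (r s)\<close> and \<open>sinh (r s) / r\<close> with \<open>r\<^sup>2 = \<delta>\<close>, which are trigonometric for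
  \<open>\<delta> < 0\<close> and degenerate to \<open>1\<close> and \<open>s\<close> for \<open>\<delta> = 0\<close>. Their growth rate is below \<open>\<tau>\<close> because
  \<open>\<delta> < \<tau>\<^sup>2\<close>.
\<close>

lemma oscillator_flow:
  fixes \<tau> \<delta> :: real
  assumes \<tau>: "\<tau> > 0" and \<delta>: "\<delta> < \<tau>\<^sup>2"
  obtains C S :: "real \<Rightarrow> real" where "C 0 = 1" "S 0 = 0"
    "\<And>s. (C has_real_derivative \<delta> * S s) (at s)" "\<And>s. (S has_real_derivative C s) (at s)"
    "((\<lambda>s. exp (- \<tau> * s) * C s) \<longlongrightarrow> 0) at_top" "((\<lambda>s. exp (- \<tau> * s) * S s) \<longlongrightarrow> 0) at_top"
proof -
  have e0: "((\<lambda>s. exp (- c * s)) \<longlongrightarrow> 0) at_top" if "c > 0" for c :: real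
    using that by real_asymp
  consider "\<delta> > 0" | "\<delta> = 0" | "\<delta> < 0" by linarith
  then show thesis
  proof cases
    case 1
    define r where "r = sqrt \<delta>"
    have r: "r > 0" "r * r = \<delta>" "r < \<tau>"
      using 1 \<delta> \<tau> by (auto simp: r_def intro: real_less_lsqrt)
    have eC: "exp (- \<tau> * s) * ((exp (r * s) + exp (- r * s)) / 2) = (exp (- (\<tau> - r) * s) + exp (- (\<tau> + r) * s)) / 2" for s
      by (simp add: distrib_left flip: exp_add) (simp add: algebra_simps)
    have eS: "exp (- \<tau> * s) * ((exp (r * s) - exp (- r * s)) / (2 * r)) = (exp (- (\<tau> - r) * s) - exp (- (\<tau> + r) * s)) / (2 * r)" for s
      by (simp add: right_diff_distrib flip: exp_add) (simp add: algebra_simps)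
    show thesis
    proof (rule that[of "\<lambda>s. (exp (r * s) + exp (- r * s)) / 2" "\<lambda>s. (exp (r * s) - exp (- r * s)) / (2 * r)"])
      show "((\<lambda>s. exp (- \<tau> * s) * ((exp (r * s) + exp (- r * s)) / 2)) \<longlongrightarrow> 0) at_top"
        unfolding eC using tendsto_divide[OF tendsto_add[OF e0[of "\<tau> - r"] e0[of "\<tau> + r"]] tendsto_const[of 2]] r \<tau> by simp
      show "((\<lambda>s. exp (- \<tau> * s) * ((exp (r * s) - exp (- r * s)) / (2 * r))) \<longlongrightarrow> 0) at_top"
        unfolding eS using tendsto_divide[OF tendsto_diff[OF e0[of "\<tau> - r"] e0[of "\<tau> + r"]] tendsto_const[of "2 * r"]] r \<tau> by simp
    qed (use r in \<open>auto intro!: derivative_eq_intros simp: field_simps simp flip: r(2)\<close>)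
  next
    case 2
    show thesis
    proof (rule that[of "\<lambda>_. 1" "\<lambda>s. s"])
      show "((\<lambda>s. exp (- \<tau> * s) * s) \<longlongrightarrow> 0) at_top" using \<tau> by real_asymp
    qed (use 2 \<tau> e0[of \<tau>] in \<open>auto intro!: derivative_eq_intros\<close>)
  next
    case 3
    define w where "w = sqrt (- \<delta>)"
    have w: "w > 0" "\<delta> = - (w * w)" using 3 by (auto simp: w_def)
    show thesis
    proof (rule that[of "\<lambda>s. cos (w * s)" "\<lambda>s. sin (w * s) / w"])
      show "((\<lambda>s. exp (- \<tau> * s) * cos (w * s)) \<longlongrightarrow> 0) at_top"
        by (rule Lim_null_comparison[OF _ e0[OF \<tau>]]) (auto simp: abs_mult intro!: always_eventually)
      have "((\<lambda>s. exp (- \<tau> * s) * sin (w * s)) \<longlongrightarrow> 0) at_top"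
        by (rule Lim_null_comparison[OF _ e0[OF \<tau>]]) (auto simp: abs_mult intro!: always_eventually)
      from tendsto_divide[OF this tendsto_const[of w]] w
      show "((\<lambda>s. exp (- \<tau> * s) * (sin (w * s) / w)) \<longlongrightarrow> 0) at_top" by simp
    qed (use w in \<open>auto intro!: derivative_eq_intros simp: field_simps\<close>)
  qed
qed

text \<open>
  The matrix exponential \<open>exp (- s A)\<close>, written as \<open>p s I + q s A\<close>. By Cayley-Hamilton the
  equation for \<open>E\<close> becomes a linear system for the scalar functions \<open>p\<close> and \<open>q\<close>, which is
  a damped oscillator with damping \<open>tr A / 2\<close> and discriminant \<open>(tr A / 2)\<^sup>2 - det A\<close>.
\<close>

lemma stable_matrix_flow:
  fixes A :: "real^2^2"
  assumes tr: "A$1$1 + A$2$2 > 0" and d: "det A > 0"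
  obtains E :: "real \<Rightarrow> real^2^2" where "E 0 = mat 1"
    "\<And>s. (E has_vector_derivative - (E s ** A)) (at s)" "(E \<longlongrightarrow> 0) at_top"
proof -
  define \<tau> where "\<tau> = (A$1$1 + A$2$2) / 2"
  have \<tau>: "\<tau> > 0" using tr by (simp add: \<tau>_def)
  obtain C S where CS: "C 0 = 1" "S 0 = 0"
    "\<And>s. (C has_real_derivative (\<tau>\<^sup>2 - det A) * S s) (at s)" "\<And>s. (S has_real_derivative C s) (at s)"
    "((\<lambda>s. exp (- \<tau> * s) * C s) \<longlongrightarrow> 0) at_top" "((\<lambda>s. exp (- \<tau> * s) * S s) \<longlongrightarrow> 0) at_top"
    using oscillator_flow[of \<tau> "\<tau>\<^sup>2 - det A"] \<tau> d by auto
  \<comment> \<open>The coefficients of \<open>exp (- \<tau> s) (C s I - S s (A - \<tau> I))\<close>.\<close>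
  define p where "p s = exp (- \<tau> * s) * C s + \<tau> * (exp (- \<tau> * s) * S s)" for s
  define q where "q s = - (exp (- \<tau> * s) * S s)" for s
  have p': "(p has_real_derivative det A * q s) (at s)" for s
    unfolding p_def q_def by (auto intro!: derivative_eq_intros CS(3,4) simp: algebra_simps power2_eq_square)
  have q': "(q has_real_derivative - p s - 2 * \<tau> * q s) (at s)" for s
    unfolding p_def q_def by (auto intro!: derivative_eq_intros CS(3,4) simp: algebra_simps)
  \<comment> \<open>Cayley-Hamilton.\<close>
  have CH: "A ** A = (2 * \<tau>) *\<^sub>R A - det A *\<^sub>R mat 1"
    by (simp add: vec_eq_iff forall_2 matrix_matrix_mult_def sum_2 det_2 mat_def \<tau>_def algebra_simps)
  have mA: "(p s *\<^sub>R mat 1 + q s *\<^sub>R A) ** A = p s *\<^sub>R A + q s *\<^sub>R (A ** A)" for s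
    by (simp add: vec_eq_iff forall_2 matrix_matrix_mult_def sum_2 mat_def algebra_simps)
  show thesis
  proof (rule that[of "\<lambda>s. p s *\<^sub>R mat 1 + q s *\<^sub>R A"])
    show "p 0 *\<^sub>R mat 1 + q 0 *\<^sub>R A = mat 1" using CS by (simp add: p_def q_def)
    have "((\<lambda>s. p s *\<^sub>R mat 1 + q s *\<^sub>R A) has_vector_derivative
        (det A * q s) *\<^sub>R mat 1 + (- p s - 2 * \<tau> * q s) *\<^sub>R A) (at s)" for s
      using p' q' by (auto intro!: derivative_eq_intros)
    moreover have "(det A * q s) *\<^sub>R mat 1 + (- p s - 2 * \<tau> * q s) *\<^sub>R A = - ((p s *\<^sub>R mat 1 + q s *\<^sub>R A) ** A)" for s
      unfolding mA CH by (simp add: algebra_simps)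
    ultimately show "((\<lambda>s. p s *\<^sub>R mat 1 + q s *\<^sub>R A) has_vector_derivative - ((p s *\<^sub>R mat 1 + q s *\<^sub>R A) ** A)) (at s)" for s
      by simp
    have "(p \<longlongrightarrow> 0) at_top" "(q \<longlongrightarrow> 0) at_top"
      unfolding p_def q_def
      using tendsto_add[OF CS(5) tendsto_mult_left[OF CS(6), of \<tau>]] tendsto_minus[OF CS(6)] by simp_all
    then show "((\<lambda>s. p s *\<^sub>R mat 1 + q s *\<^sub>R A) \<longlongrightarrow> 0) at_top"
      by (auto intro!: tendsto_eq_intros)
  qed
qed

lemma quadratic_conjugate:
  fixes S E :: "real^'n^'n"
  shows "u \<bullet> ((E ** S ** transpose E) *v u) = (transpose E *v u) \<bullet> (S *v (transpose E *v u))"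
  by (simp add: dot_lmul_matrix flip: matrix_vector_mul_assoc)

text \<open>
  Here \<open>E t\<close> plays the role of \<open>exp (- t A)\<close>, and the last assumption is the Lyapunov equation
  \<open>A S + S A\<^sup>T = B B\<^sup>T\<close> in terms of quadratic forms.
\<close>

locale stable_linear_sde =
  fixes A S :: "real^'n^'n" and B :: "real^'n" and E :: "real \<Rightarrow> real^'n^'n"
  assumes E0: "E 0 = mat 1"
    and E': "\<And>s. (E has_vector_derivative - (E s ** A)) (at s)"
    and sym: "transpose S = S"
    and lyapunov: "\<And>u. 2 * ((transpose A *v u) \<bullet> (S *v u)) = (u \<bullet> B)\<^sup>2"
begin

definition cov :: "real \<Rightarrow> real^'n^'n" where
  "cov t = S - E t ** S ** transpose (E t)"

lemma inner_cov: "u \<bullet> (cov t *v u) = u \<bullet> (S *v u) - (transpose (E t) *v u) \<bullet> (S *v (transpose (E t) *v u))"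
  unfolding cov_def
  by (simp only: matrix_vector_mult_diff_rdistrib inner_diff_right quadratic_conjugate)

lemma transpose_cov: "transpose (cov t) = cov t"
proof -
  have "transpose (X - Y) = transpose X - transpose Y" for X Y :: "real^'n^'n"
    by (simp add: transpose_def vec_eq_iff)
  then show ?thesis
    by (simp add: cov_def matrix_transpose_mul sym matrix_mul_assoc)
qed

text \<open>
  The solution of the adjoint equation with value \<open>u\<close> at time \<open>t\<close>.
\<close>

lemma adjoint_flow:
  "((\<lambda>s. transpose (E (t - s)) *v u) has_vector_derivative
      transpose A *v (transpose (E (t - s)) *v u)) (at s within X)"
proof -
  have "linear (\<lambda>Y. transpose Y *v u :: real^'n)"
    by (auto intro!: linearI simp: transpose_def matrix_vector_mult_def vec_eq_iff sum.distrib algebra_simps sum_distrib_left)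
  then have bl: "bounded_linear (\<lambda>Y. transpose Y *v u :: real^'n)"
    by (simp add: linear_conv_bounded_linear)
  have "((\<lambda>s. E (t - s)) has_vector_derivative (-1) *\<^sub>R - (E (t - s) ** A)) (at s within X)"
    by (rule vector_diff_chain_within[where f="\<lambda>s. t - s" and g=E, unfolded comp_def])
       (auto intro!: derivative_eq_intros has_vector_derivative_at_within[OF E'])
  from bounded_linear.has_vector_derivative[OF bl this]
  show ?thesis by (simp only: scaleR_minus1_left minus_minus matrix_transpose_mul matrix_vector_mul_assoc)
qed

text \<open>
  The Lyapunov equation turns \<open>(a \<bullet> B)\<^sup>2\<close> into an exact derivative along the adjoint flow.
\<close>

lemma energy_derivative:
  "((\<lambda>s. (transpose (E (t - s)) *v u) \<bullet> (S *v (transpose (E (t - s)) *v u))) has_real_derivative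
      ((transpose (E (t - s)) *v u) \<bullet> B)\<^sup>2) (at s within X)"
proof -
  let ?a = "\<lambda>s. transpose (E (t - s)) *v u"
  have "((\<lambda>s. S *v ?a s) has_vector_derivative S *v (transpose A *v ?a s)) (at s within X)"
    by (rule bounded_linear.has_vector_derivative[OF matrix_vector_mul_bounded_linear adjoint_flow])
  from bounded_bilinear.has_vector_derivative[OF bounded_bilinear_inner adjoint_flow this]
  have "((\<lambda>s. ?a s \<bullet> (S *v ?a s)) has_real_derivative
      ?a s \<bullet> (S *v (transpose A *v ?a s)) + (transpose A *v ?a s) \<bullet> (S *v ?a s)) (at s within X)"
    by (simp only: has_real_derivative_iff_has_vector_derivative)
  also have "?a s \<bullet> (S *v (transpose A *v ?a s)) = (transpose A *v ?a s) \<bullet> (S *v ?a s)"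
    by (metis dot_lmul_matrix inner_commute sym transpose_matrix_vector)
  finally show ?thesis by (simp only: lyapunov[symmetric] mult_2)
qed

lemma mchar_solution:
  assumes "linear_sde_solution A B M F W Z" "t \<ge> 0"
  shows "mchar (distr M borel (Z t)) u =
    mchar (distr M borel (Z 0)) (transpose (E t) *v u) * exp (- (u \<bullet> (cov t *v u)) / 2)"
proof (cases "t = 0")
  case True
  then show ?thesis by (simp add: inner_cov E0)
next
  case False
  then have "t > 0" using assms by simp
  from linear_sde_mchar[OF assms(1) this adjoint_flow[of t u] energy_derivative[of t u]]
  show ?thesis by (simp add: E0 inner_cov)
qed

lemma energy_mono:
  assumes "x \<le> y"
  shows "(transpose (E (t - x)) *v u) \<bullet> (S *v (transpose (E (t - x)) *v u)) \<le>
    (transpose (E (t - y)) *v u) \<bullet> (S *v (transpose (E (t - y)) *v u))"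
  by (rule DERIV_nonneg_imp_nondecreasing[OF assms]) (use energy_derivative[of t u _ UNIV] zero_le_power2 in blast)

lemma inner_cov_nonneg: "t \<ge> 0 \<Longrightarrow> 0 \<le> u \<bullet> (cov t *v u)"
  using energy_mono[of 0 t t u] by (simp add: inner_cov E0)

text \<open>
  The energy is nondecreasing; if it agrees at both ends of \<open>[0, t]\<close>, it is constant, and its
  derivative vanishes.
\<close>

lemma inner_cov_eq_0:
  assumes t: "t > 0" and eq: "u \<bullet> (cov t *v u) = 0" and s: "0 < s" "s < t"
  shows "(transpose (E (t - s)) *v u) \<bullet> B = 0"
proof -
  let ?Q = "\<lambda>s. (transpose (E (t - s)) *v u) \<bullet> (S *v (transpose (E (t - s)) *v u))"
  \<comment> \<open>\<open>?Q t - ?Q 0\<close> is the variance in direction \<open>u\<close>, since the adjoint solution equals \<open>u\<close> at time \<open>t\<close>.\<close>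
  have "?Q t = ?Q 0" using eq by (simp add: inner_cov E0)
  then have const: "?Q x = ?Q 0" if "x \<in> {0<..<t}" for x
    using energy_mono[of 0 x t u] energy_mono[of x t t u] that by auto
  have "(?Q has_real_derivative 0) (at s)"
  proof (rule has_field_derivative_transform_within_open[where f="\<lambda>_. ?Q 0" and S="{0<..<t}"])
    show "((\<lambda>_. ?Q 0) has_real_derivative 0) (at s)" by (rule DERIV_const)
    show "?Q 0 = ?Q x" if "x \<in> {0<..<t}" for x using const[OF that] by simp
  qed (use s in auto)
  from DERIV_unique[OF this energy_derivative[of t u s UNIV]]
  show ?thesis by simp
qed

text \<open>
  Kalman's controllability condition, truncated after \<open>A B\<close>. If the variance in direction \<open>u\<close>
  vanishes, then the adjoint solution \<open>a\<close> satisfies \<open>a \<bullet> B = 0\<close> on \<open>(0, t)\<close>, and so does its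
  derivative, \<open>a \<bullet> A B = 0\<close>. Hence \<open>a = 0\<close> there, and \<open>u = a t = 0\<close> by continuity.
\<close>

lemma inner_cov_pos:
  assumes kalman: "\<And>v. v \<bullet> B = 0 \<Longrightarrow> v \<bullet> (A *v B) = 0 \<Longrightarrow> v = 0" and t: "t > 0" and u: "u \<noteq> 0"
  shows "0 < u \<bullet> (cov t *v u)"
proof (rule ccontr)
  assume "\<not> 0 < u \<bullet> (cov t *v u)"
  then have eq: "u \<bullet> (cov t *v u) = 0" using inner_cov_nonneg[of t u] t by simp
  let ?a = "\<lambda>s. transpose (E (t - s)) *v u"
  have aB: "?a s \<bullet> B = 0" if "0 < s" "s < t" for s
    using inner_cov_eq_0[OF t eq that] .
  have a0: "?a s = 0" if s: "0 < s" "s < t" for s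
  proof (rule kalman)
    show "?a s \<bullet> B = 0" using aB[OF s] .
    have "((\<lambda>s. ?a s \<bullet> B) has_vector_derivative (transpose A *v ?a s) \<bullet> B) (at s)"
      by (rule bounded_linear.has_vector_derivative[OF bounded_linear_inner_left adjoint_flow])
    moreover have "((\<lambda>s. ?a s \<bullet> B) has_vector_derivative 0) (at s)"
    proof (rule has_vector_derivative_transform_within_open[where f="\<lambda>_. 0" and S="{0<..<t}"])
      show "0 = ?a x \<bullet> B" if "x \<in> {0<..<t}" for x using aB[of x] that by simp
    qed (use s in auto)
    ultimately have "(transpose A *v ?a s) \<bullet> B = 0" by (rule vector_derivative_unique_at)
    then show "?a s \<bullet> (A *v B) = 0" by (simp add: dot_lmul_matrix)
  qed
  have "continuous (at t within {..<t}) ?a"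
    by (rule has_vector_derivative_continuous[OF adjoint_flow])
  then have "(?a \<longlongrightarrow> ?a t) (at_left t)" by (simp add: continuous_within)
  moreover have "(?a \<longlongrightarrow> 0) (at_left t)"
  proof (rule tendsto_eventually)
    show "\<forall>\<^sub>F s in at_left t. ?a s = 0"
      using eventually_at_left_real[OF t] by eventually_elim (use a0 in auto)
  qed
  ultimately have "?a t = 0"
    using tendsto_unique[OF trivial_limit_at_left_real] by blast
  then show False using u by (simp add: E0)
qed

lemma gaussian_solution:
  assumes sol: "linear_sde_solution A B M F W Z" and t: "t \<ge> 0"
    and g: "gaussian m S0 (distr M borel (Z 0))"
  shows "gaussian (E t *v m) (E t ** S0 ** transpose (E t) + cov t) (distr M borel (Z t))"
proof (subst gaussian_iff_mchar)
  have M: "prob_space M" and "Z t \<in> borel_measurable M"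
    using sol t by (auto simp: linear_sde_solution_def brownian_motion_def intro: measurable_from_subalg)
  then show "prob_space (distr M borel (Z t))" by (intro prob_space.prob_space_distr)
  have tr: "transpose (X + Y) = transpose X + transpose Y" for X Y :: "real^'n^'n"
    by (simp add: transpose_def vec_eq_iff)
  show "transpose (E t ** S0 ** transpose (E t) + cov t) = E t ** S0 ** transpose (E t) + cov t"
    using g by (simp add: gaussian_def tr transpose_cov matrix_transpose_mul matrix_mul_assoc)
  have quad: "u \<bullet> ((E t ** S0 ** transpose (E t) + cov t) *v u) =
      (transpose (E t) *v u) \<bullet> (S0 *v (transpose (E t) *v u)) + u \<bullet> (cov t *v u)" for u
    by (simp only: matrix_vector_mult_add_rdistrib inner_add_right quadratic_conjugate)
  show "0 \<le> u \<bullet> ((E t ** S0 ** transpose (E t) + cov t) *v u)" for u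
    unfolding quad using g inner_cov_nonneg[OF t, of u] by (simp add: gaussian_def)
  show "\<forall>u. mchar (distr M borel (Z t)) u =
      iexp (u \<bullet> (E t *v m)) * exp (- (u \<bullet> ((E t ** S0 ** transpose (E t) + cov t) *v u)) / 2)"
  proof
    fix u
    have "(transpose (E t) *v u) \<bullet> m = u \<bullet> (E t *v m)" by (simp add: dot_lmul_matrix)
    moreover have "exp (- (x + y) / 2) = exp (- x / 2) * exp (- y / 2)" for x y :: real
      by (simp add: diff_divide_distrib flip: exp_add)
    ultimately show "mchar (distr M borel (Z t)) u =
      iexp (u \<bullet> (E t *v m)) * exp (- (u \<bullet> ((E t ** S0 ** transpose (E t) + cov t) *v u)) / 2)"
      unfolding quad mchar_solution[OF sol t] gaussian_mchar[OF g]
      by (simp only: of_real_mult mult.assoc)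
  qed
qed simp

lemma gaussian_solution_stationary:
  assumes "linear_sde_solution A B M F W Z" "t \<ge> 0" "gaussian 0 S (distr M borel (Z 0))"
  shows "gaussian 0 S (distr M borel (Z t))"
  using gaussian_solution[OF assms] by (simp add: cov_def)

lemma tendsto_flow_vector:
  assumes "(E \<longlongrightarrow> 0) at_top"
  shows "((\<lambda>t. E t *v m) \<longlongrightarrow> 0) at_top"
proof (rule vec_tendstoI)
  have Eij: "((\<lambda>t. E t $ i $ j) \<longlongrightarrow> 0) at_top" for i j
    using tendsto_vec_nth[OF tendsto_vec_nth[OF assms, of i], of j] by simp
  have "((\<lambda>t. \<Sum>j\<in>UNIV. E t $ i $ j * m $ j) \<longlongrightarrow> (\<Sum>j\<in>UNIV. 0 * m $ j)) at_top" for i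
    by (intro tendsto_sum tendsto_mult tendsto_const Eij)
  then show "((\<lambda>t. (E t *v m) $ i) \<longlongrightarrow> 0 $ i) at_top" for i
    by (simp add: matrix_vector_mult_def)
qed

lemma tendsto_conjugate:
  fixes S0 :: "real^'n^'n"
  assumes "(E \<longlongrightarrow> 0) at_top"
  shows "((\<lambda>t. E t ** S0 ** transpose (E t)) \<longlongrightarrow> 0) at_top"
proof (intro vec_tendstoI)
  have Eij: "((\<lambda>t. E t $ i $ j) \<longlongrightarrow> 0) at_top" for i j
    using tendsto_vec_nth[OF tendsto_vec_nth[OF assms, of i], of j] by simp
  show "((\<lambda>t. (E t ** S0 ** transpose (E t)) $ i $ j) \<longlongrightarrow> 0 $ i $ j) at_top" for i j
  proof -
    have "((\<lambda>t. \<Sum>k\<in>UNIV. (\<Sum>l\<in>UNIV. E t $ i $ l * S0 $ l $ k) * E t $ j $ k) \<longlongrightarrow>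
        (\<Sum>k\<in>UNIV. (\<Sum>l\<in>UNIV. 0 * S0 $ l $ k) * 0)) at_top"
      by (intro tendsto_sum tendsto_mult tendsto_const Eij)
    then show ?thesis by (simp add: matrix_matrix_mult_def transpose_def)
  qed
qed

end

lemma invertible_if_posdef:
  fixes S :: "real^'n^'n"
  assumes "\<And>u. u \<noteq> 0 \<Longrightarrow> u \<bullet> (S *v u) > 0"
  shows "invertible S"
proof -
  have "\<exists>T. T ** S = mat 1"
    unfolding matrix_left_invertible_ker using assms by (metis inner_zero_right less_irrefl)
  then show ?thesis by (simp add: invertible_left_inverse)
qed

text \<open>
  Sylvester's criterion, obtained by testing with \<open>(1, 0)\<close> and \<open>(- S$1$2, S$1$1)\<close>.
\<close>

lemma posdef_2:
  fixes S :: "real^2^2"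
  assumes "transpose S = S" and "\<And>u. u \<noteq> 0 \<Longrightarrow> 0 < u \<bullet> (S *v u)"
  shows "S$1$1 > 0" "(S$1$2)\<^sup>2 < S$1$1 * S$2$2"
proof -
  have "vector [1, 0] \<noteq> (0 :: real^2)" by (simp add: vec_eq_iff forall_2)
  from assms(2)[OF this] show pos: "S$1$1 > 0" by (simp add: inner_mult_2)
  then have "vector [- S$1$2, S$1$1] \<noteq> (0 :: real^2)" by (simp add: vec_eq_iff forall_2)
  from assms(2)[OF this] have "0 < S$1$1 * (S$1$1 * S$2$2 - (S$1$2)\<^sup>2)"
    using assms(1)[unfolded transpose_2] by (simp add: inner_mult_2 power2_eq_square algebra_simps)
  then show "(S$1$2)\<^sup>2 < S$1$1 * S$2$2" using pos by (simp add: zero_less_mult_iff)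
qed

section \<open>Smooth densities\<close>

text \<open>
  Polynomials times a fixed Gaussian. Unlike the Gaussian alone, this class is closed
  under directional derivatives, which makes smoothness of convolutions an induction.
\<close>

inductive poly_exp :: "'a::euclidean_space \<Rightarrow> 'a \<Rightarrow> ('a \<Rightarrow> real) \<Rightarrow> bool" for l1 l2 where
  base: "poly_exp l1 l2 (\<lambda>z. exp (- ((l1 \<bullet> z)\<^sup>2 + (l2 \<bullet> z)\<^sup>2) / 2))"
| add: "poly_exp l1 l2 f \<Longrightarrow> poly_exp l1 l2 g \<Longrightarrow> poly_exp l1 l2 (\<lambda>z. f z + g z)"
| scale: "poly_exp l1 l2 f \<Longrightarrow> poly_exp l1 l2 (\<lambda>z. c * f z)"
| linear: "poly_exp l1 l2 f \<Longrightarrow> poly_exp l1 l2 (\<lambda>z. (v \<bullet> z) * f z)"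

lemma poly_exp_has_derivative:
  assumes "poly_exp l1 l2 f"
  obtains D where "\<And>z. (f has_derivative D z) (at z)" "\<And>v. poly_exp l1 l2 (\<lambda>z. D z v)"
proof -
  from assms have "\<exists>D. (\<forall>z. (f has_derivative D z) (at z)) \<and> (\<forall>v. poly_exp l1 l2 (\<lambda>z. D z v))"
  proof induction
    case base
    let ?e = "\<lambda>z. exp (- ((l1 \<bullet> z)\<^sup>2 + (l2 \<bullet> z)\<^sup>2) / 2)"
    let ?D = "\<lambda>z v. (- (l1 \<bullet> v)) * ((l1 \<bullet> z) * ?e z) + (- (l2 \<bullet> v)) * ((l2 \<bullet> z) * ?e z)"
    show ?case
      by (intro exI[of _ ?D] conjI allI poly_exp.intros)
         (auto intro!: derivative_eq_intros simp: field_simps fun_eq_iff)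
  next
    case (add f g)
    then obtain D D' where "\<forall>z. (f has_derivative D z) (at z)" "\<forall>v. poly_exp l1 l2 (\<lambda>z. D z v)"
      "\<forall>z. (g has_derivative D' z) (at z)" "\<forall>v. poly_exp l1 l2 (\<lambda>z. D' z v)" by blast
    then show ?case
      by (intro exI[of _ "\<lambda>z v. D z v + D' z v"]) (auto intro!: derivative_eq_intros poly_exp.intros)
  next
    case (scale f c)
    then obtain D where "\<forall>z. (f has_derivative D z) (at z)" "\<forall>v. poly_exp l1 l2 (\<lambda>z. D z v)" by blast
    then show ?case
      by (intro exI[of _ "\<lambda>z v. c * D z v"]) (auto intro!: derivative_eq_intros poly_exp.intros)
  next
    case (linear f w)
    then obtain D where D: "\<forall>z. (f has_derivative D z) (at z)" "\<forall>v. poly_exp l1 l2 (\<lambda>z. D z v)" by blast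
    show ?case
    proof (intro exI conjI allI)
      show "((\<lambda>z. (w \<bullet> z) * f z) has_derivative (\<lambda>v. (w \<bullet> v) * f z + (w \<bullet> z) * D z v)) (at z)" for z
        using D by (auto intro!: derivative_eq_intros simp: algebra_simps)
      show "poly_exp l1 l2 (\<lambda>z. (w \<bullet> v) * f z + (w \<bullet> z) * D z v)" for v
        using D linear.hyps by (intro poly_exp.add poly_exp.scale poly_exp.linear) auto
    qed
  qed
  then show thesis using that by blast
qed

lemma power_gaussian_bounded:
  fixes c :: real
  assumes "c > 0"
  shows "\<exists>K. \<forall>x\<ge>0. x ^ n * exp (- c * x\<^sup>2) \<le> K"
proof (intro exI allI impI)
  fix x :: real assume x: "x \<ge> 0"
  have "x ^ n / fact n \<le> exp x"
    using sum_le_suminf[OF summable_exp_generic[of x], of "{n}"] x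
    by (simp add: exp_def divide_inverse mult.commute)
  \<comment> \<open>The exponential absorbs the power \<open>x ^ n\<close>; the maximum of \<open>x - c x\<^sup>2\<close> is \<open>1 / (4 c)\<close>.\<close>
  moreover have "x - c * x\<^sup>2 \<le> 1 / (4 * c)"
    using assms zero_le_power2[of "2 * c * x - 1"] by (simp add: field_simps power2_eq_square)
  then have "exp (x - c * x\<^sup>2) \<le> exp (1 / (4 * c))" by simp
  ultimately have "x ^ n / fact n * exp (- c * x\<^sup>2) \<le> exp (1 / (4 * c))"
    by (smt (verit, ccfv_SIG) exp_ge_zero mult_exp_exp mult_right_mono mult_minus_left)
  then show "x ^ n * exp (- c * x\<^sup>2) \<le> fact n * exp (1 / (4 * c))"
    by (simp add: field_simps)
qed

text \<open>
  The induction over the class goes through because the claim is proved simultaneously for all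
  products with powers of the norm: a linear factor only raises the power by one.
\<close>

lemma poly_exp_bounded:
  assumes "poly_exp l1 l2 f" and c: "c > 0" "\<And>z. c * (norm z)\<^sup>2 \<le> ((l1 \<bullet> z)\<^sup>2 + (l2 \<bullet> z)\<^sup>2) / 2"
  shows "\<exists>K. \<forall>z. \<bar>f z\<bar> \<le> K"
proof -
  from assms(1) have "\<exists>K. \<forall>z. norm z ^ n * \<bar>f z\<bar> \<le> K" for n
  proof (induction arbitrary: n)
    case base
    obtain K where K: "\<And>x. x \<ge> 0 \<Longrightarrow> x ^ n * exp (- c * x\<^sup>2) \<le> K" using power_gaussian_bounded[OF c(1), of n] by blast
    have "norm z ^ n * exp (- ((l1 \<bullet> z)\<^sup>2 + (l2 \<bullet> z)\<^sup>2) / 2) \<le> K" for z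
    proof -
      have "norm z ^ n * exp (- ((l1 \<bullet> z)\<^sup>2 + (l2 \<bullet> z)\<^sup>2) / 2) \<le> norm z ^ n * exp (- c * (norm z)\<^sup>2)"
        using c(2)[of z] by (intro mult_left_mono) auto
      also have "\<dots> \<le> K" by (rule K) simp
      finally show ?thesis .
    qed
    then show ?case by auto
  next
    case (add f g)
    from add.IH[of n] obtain K K' where K: "\<And>z. norm z ^ n * \<bar>f z\<bar> \<le> K" "\<And>z. norm z ^ n * \<bar>g z\<bar> \<le> K'" by auto
    have "norm z ^ n * \<bar>f z + g z\<bar> \<le> K + K'" for z
      using mult_left_mono[OF abs_triangle_ineq[of "f z" "g z"], of "norm z ^ n"] K[of z]
      by (simp add: distrib_left)
    then show ?case by blast
  next
    case (scale f b)
    from scale.IH[of n] obtain K where "\<forall>z. norm z ^ n * \<bar>f z\<bar> \<le> K" by auto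
    then have "norm z ^ n * \<bar>b * f z\<bar> \<le> \<bar>b\<bar> * K" for z
      using mult_left_mono[of "norm z ^ n * \<bar>f z\<bar>" K "\<bar>b\<bar>"] by (simp add: abs_mult algebra_simps)
    then show ?case by blast
  next
    case (linear f v)
    from linear.IH[of "Suc n"] obtain K where K: "\<forall>z. norm z ^ Suc n * \<bar>f z\<bar> \<le> K" by auto
    have "norm z ^ n * \<bar>(v \<bullet> z) * f z\<bar> \<le> norm v * K" for z
    proof -
      have "norm z ^ n * \<bar>(v \<bullet> z) * f z\<bar> = norm z ^ n * \<bar>f z\<bar> * \<bar>v \<bullet> z\<bar>" by (simp add: abs_mult)
      also have "\<dots> \<le> norm z ^ n * \<bar>f z\<bar> * (norm v * norm z)"
        by (intro mult_left_mono Cauchy_Schwarz_ineq2) auto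
      also have "\<dots> = norm v * (norm z ^ Suc n * \<bar>f z\<bar>)" by simp
      also have "\<dots> \<le> norm v * K" using K by (intro mult_left_mono) auto
      finally show ?thesis .
    qed
    then show ?case by blast
  qed
  from this[of 0] show ?thesis by simp
qed

text \<open>
  Differentiation under the integral. The difference quotients are dominated by \<open>2 K'\<close>, the
  derivative bound giving a Lipschitz constant for \<open>f\<close>.
\<close>

lemma convolution_has_derivative:
  fixes f :: "'a::euclidean_space \<Rightarrow> real"
  assumes "finite_measure \<mu>" and [measurable]: "X \<in> borel_measurable \<mu>"
    and D: "\<And>z. (f has_derivative D z) (at z)"
    and bdd: "\<And>z. \<bar>f z\<bar> \<le> K" "\<And>v z. \<bar>D z v\<bar> \<le> K' * norm v"
  shows "((\<lambda>z. \<integral>w. f (z - X w) \<partial>\<mu>) has_derivative (\<lambda>v. \<integral>w. D (z - X w) v \<partial>\<mu>)) (at z)"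
proof -
  interpret finite_measure \<mu> by fact
  have contf: "continuous_on UNIV f"
    using D by (auto simp: continuous_on_eq_continuous_at intro: has_derivative_continuous)
  then have [measurable]: "f \<in> borel_measurable borel" by (rule borel_measurable_continuous_onI)
  have lin: "linear (D z)" for z using has_derivative_linear[OF D] .
  \<comment> \<open>Directional derivatives are limits of difference quotients, hence measurable.\<close>
  have Dm[measurable]: "(\<lambda>z. D z v) \<in> borel_measurable borel" for v
  proof (rule borel_measurable_LIMSEQ_real)
    fix z
    have "((\<lambda>h. (f (z + h *\<^sub>R v) - f z) / h) \<longlongrightarrow> D z v) (at 0)"
    proof -
      have "((\<lambda>h. f (z + h *\<^sub>R v)) has_derivative (\<lambda>h. D z (h *\<^sub>R v))) (at 0)"
        by (rule has_derivative_compose[of "\<lambda>h. z + h *\<^sub>R v" "\<lambda>h. h *\<^sub>R v" 0 UNIV f "D z"])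
           (use D[of z] in \<open>auto intro!: derivative_eq_intros\<close>)
      then have "((\<lambda>h. f (z + h *\<^sub>R v)) has_real_derivative D z v) (at 0)"
        by (simp add: has_field_derivative_def linear_cmul[OF lin] mult_commute_abs)
      then show ?thesis by (simp add: DERIV_def)
    qed
    moreover have "filterlim (\<lambda>n. 1 / real (Suc n)) (at 0) sequentially"
      using LIMSEQ_inverse_real_of_nat by (simp add: filterlim_at inverse_eq_divide)
    ultimately show "(\<lambda>n. (f (z + (1 / real (Suc n)) *\<^sub>R v) - f z) / (1 / real (Suc n))) \<longlonglongrightarrow> D z v"
      by (rule filterlim_compose)
  qed measurable
  have intD: "integrable \<mu> (\<lambda>w. D (z - X w) v)" for z v
    by (rule integrable_const_bound[where B="K' * norm v"]) (use bdd in auto)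
  have intf: "integrable \<mu> (\<lambda>w. f (z - X w))" for z
    by (rule integrable_const_bound[where B=K]) (use bdd in auto)
  have "K' \<ge> 0"
    using bdd(2)[of 0 "SOME b. b \<in> Basis"] by (simp add: SOME_Basis) 
  have "onorm (D x) \<le> K'" for x
    by (rule onorm_bound) (use bdd(2) \<open>K' \<ge> 0\<close> in auto)
  then have lip: "\<bar>f y - f x\<bar> \<le> K' * norm (y - x)" for x y
    using differentiable_bound[of UNIV f D K' y x] D by simp
  show ?thesis
    unfolding has_derivative_iff_norm
  proof
    show "bounded_linear (\<lambda>v. \<integral>w. D (z - X w) v \<partial>\<mu>)"
      unfolding linear_conv_bounded_linear[symmetric]
      using intD by (intro linearI) (simp_all add: linear_add[OF lin] linear_cmul[OF lin])
    show "((\<lambda>y. norm ((\<integral>w. f (y - X w) \<partial>\<mu>) - (\<integral>w. f (z - X w) \<partial>\<mu>) - (\<integral>w. D (z - X w) (y - z) \<partial>\<mu>)) / norm (y - z)) \<longlongrightarrow> 0) (at z)"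
      unfolding tendsto_at_iff_sequentially comp_def
    proof (intro allI impI)
      fix y assume y: "\<forall>i. y i \<in> UNIV - {z}" "y \<longlonglongrightarrow> z"
      let ?q = "\<lambda>i w. (f (y i - X w) - f (z - X w) - D (z - X w) (y i - z)) / norm (y i - z)"
      have lim: "(\<lambda>i. \<integral>w. ?q i w \<partial>\<mu>) \<longlonglongrightarrow> (\<integral>w. 0 \<partial>\<mu>)"
      proof (rule integral_dominated_convergence[where w="\<lambda>_. 2 * K'"])
        show "AE w in \<mu>. (\<lambda>i. ?q i w) \<longlonglongrightarrow> 0"
        proof (rule AE_I2)
          fix w
          have "(\<lambda>i. y i - X w) \<longlonglongrightarrow> z - X w" by (intro tendsto_intros y)
          moreover have "((\<lambda>y. norm (f y - f (z - X w) - D (z - X w) (y - (z - X w))) / norm (y - (z - X w))) \<longlongrightarrow> 0) (at (z - X w))"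
            using D[of "z - X w"] by (simp add: has_derivative_iff_norm)
          ultimately have "(\<lambda>i. norm (f (y i - X w) - f (z - X w) - D (z - X w) (y i - z)) / norm (y i - z)) \<longlonglongrightarrow> 0"
            unfolding tendsto_at_iff_sequentially comp_def using y(1)
            by (auto dest!: spec[of _ "\<lambda>i. y i - X w"])
          then have "(\<lambda>i. norm (?q i w)) \<longlonglongrightarrow> 0" by simp
          then show "(\<lambda>i. ?q i w) \<longlonglongrightarrow> 0" by (rule tendsto_norm_zero_cancel)
        qed
        show "AE w in \<mu>. norm (?q i w) \<le> 2 * K'" for i
        proof (rule AE_I2)
          fix w
          have "\<bar>f (y i - X w) - f (z - X w) - D (z - X w) (y i - z)\<bar> \<le> K' * norm (y i - z) + K' * norm (y i - z)"
            using lip[of "y i - X w" "z - X w"] bdd(2)[of "z - X w" "y i - z"] by simp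
          then show "norm (?q i w) \<le> 2 * K'"
            using y(1) by (simp add: divide_le_eq algebra_simps)
        qed
      qed auto
      have eq: "(\<integral>w. ?q i w \<partial>\<mu>) = ((\<integral>w. f (y i - X w) \<partial>\<mu>) - (\<integral>w. f (z - X w) \<partial>\<mu>) - (\<integral>w. D (z - X w) (y i - z) \<partial>\<mu>)) / norm (y i - z)" for i
        using intf intD by simp
      have "(\<lambda>i. norm (((\<integral>w. f (y i - X w) \<partial>\<mu>) - (\<integral>w. f (z - X w) \<partial>\<mu>) - (\<integral>w. D (z - X w) (y i - z) \<partial>\<mu>)) / norm (y i - z))) \<longlonglongrightarrow> 0"
        using lim unfolding eq by (intro tendsto_norm_zero) simp
      then show "(\<lambda>i. norm ((\<integral>w. f (y i - X w) \<partial>\<mu>) - (\<integral>w. f (z - X w) \<partial>\<mu>) - (\<integral>w. D (z - X w) (y i - z) \<partial>\<mu>)) / norm (y i - z)) \<longlonglongrightarrow> 0"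
        by simp
    qed
  qed
qed

lemma smooth_convolution_poly_exp:
  fixes l1 l2 :: "'a::euclidean_space"
  assumes "finite_measure \<mu>" and X: "X \<in> borel_measurable \<mu>"
    and c: "c > 0" "\<And>z. c * (norm z)\<^sup>2 \<le> ((l1 \<bullet> z)\<^sup>2 + (l2 \<bullet> z)\<^sup>2) / 2"
    and f: "poly_exp l1 l2 f"
  shows "smooth (\<lambda>z. \<integral>w. f (z - X w) \<partial>\<mu>)"
proof -
  interpret finite_measure \<mu> by fact
  have *: "\<exists>D. (\<forall>z. ((\<lambda>z. \<integral>w. f (z - X w) \<partial>\<mu>) has_derivative (\<lambda>v. \<integral>w. D (z - X w) v \<partial>\<mu>)) (at z)) \<and>
      (\<forall>v. poly_exp l1 l2 (\<lambda>z. D z v))" if f: "poly_exp l1 l2 f" for f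
  proof -
    obtain D where D: "\<And>z. (f has_derivative D z) (at z)" "\<And>v. poly_exp l1 l2 (\<lambda>z. D z v)"
      using poly_exp_has_derivative[OF f] by blast
    obtain K where K: "\<And>z. \<bar>f z\<bar> \<le> K" using poly_exp_bounded[OF f c] by blast
    have "\<forall>b. \<exists>Kb. \<forall>z. \<bar>D z b\<bar> \<le> Kb" using poly_exp_bounded[OF D(2) c] by blast
    then obtain KD where KD: "\<And>b z. \<bar>D z b\<bar> \<le> KD b" by metis
    have "\<bar>D z v\<bar> \<le> (\<Sum>b\<in>Basis. KD b) * norm v" for z v
    proof -
      have "D z v = (\<Sum>b\<in>Basis. (v \<bullet> b) * D z b)"
        using linear_sum[OF has_derivative_linear[OF D(1)[of z]], of "\<lambda>b. (v \<bullet> b) *\<^sub>R b" Basis]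
        by (simp add: euclidean_representation linear_cmul[OF has_derivative_linear[OF D(1)[of z]]])
      also have "\<bar>\<dots>\<bar> \<le> (\<Sum>b\<in>Basis. norm v * KD b)"
        by (rule order_trans[OF sum_abs sum_mono])
           (auto simp: abs_mult intro!: mult_mono KD Basis_le_norm)
      finally show ?thesis by (simp add: sum_distrib_left mult.commute)
    qed
    from convolution_has_derivative[OF assms(1) X D(1) K this] D(2) show ?thesis by blast
  qed
  have "times_cont_differentiable n (\<lambda>z. \<integral>w. f (z - X w) \<partial>\<mu>)" for n
    using f
  proof (induction n arbitrary: f)
    case 0
    from *[OF this] show ?case
      by (auto simp: continuous_on_eq_continuous_at intro: has_derivative_continuous)
  next
    case (Suc n)
    from *[OF Suc.prems] obtain D where D: "\<And>z. ((\<lambda>z. \<integral>w. f (z - X w) \<partial>\<mu>) has_derivative (\<lambda>v. \<integral>w. D (z - X w) v \<partial>\<mu>)) (at z)"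
      "\<And>v. poly_exp l1 l2 (\<lambda>z. D z v)" by blast
    have "frechet_derivative (\<lambda>z. \<integral>w. f (z - X w) \<partial>\<mu>) (at z) = (\<lambda>v. \<integral>w. D (z - X w) v \<partial>\<mu>)" for z
      using frechet_derivative_at[OF D(1)] by simp
    then show ?case using D Suc.IH[OF D(2)] by (auto simp: differentiable_def)
  qed
  then show ?thesis by (simp add: smooth_def)
qed

text \<open>
  Identifies Lebesgue measure on \<^typ>\<open>real^2\<close> with the product measure, for the use of Fubini's theorem.
\<close>

lemma lborel_2: "distr (lborel \<Otimes>\<^sub>M lborel) borel (\<lambda>(x, y). vector [x, y]) = (lborel :: (real^2) measure)"
proof (rule lborel_eqI[symmetric])
  fix a b :: "real^2"
  have meas: "(\<lambda>(x, y). vector [x, y] :: real^2) \<in> lborel \<Otimes>\<^sub>M lborel \<rightarrow>\<^sub>M borel"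
    unfolding vector_2_eq by measurable
  assume ab: "\<And>i. i \<in> Basis \<Longrightarrow> a \<bullet> i \<le> b \<bullet> i"
  have le: "a $ i \<le> b $ i" for i
    using ab[of "axis i 1"] by (simp add: inner_axis)
  have "(\<lambda>(x, y). vector [x, y] :: real^2) -` box a b \<inter> space (lborel \<Otimes>\<^sub>M lborel) = {a$1<..<b$1} \<times> {a$2<..<b$2}"
    by (auto simp: mem_box_cart forall_2 space_pair_measure)
  then have "emeasure (distr (lborel \<Otimes>\<^sub>M lborel) borel (\<lambda>(x, y). vector [x, y] :: real^2)) (box a b) = ennreal (b$1 - a$1) * ennreal (b$2 - a$2)"
    using le by (simp add: emeasure_distr[OF meas] lborel.emeasure_pair_measure_Times)
  also have "\<dots> = ennreal (\<Prod>i\<in>Basis. (b - a) \<bullet> i)"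
  proof -
    have B: "(Basis :: (real^2) set) = {axis 1 1, axis 2 1}"
      by (auto simp: Basis_vec_def UNIV_2)
    show ?thesis
      unfolding B using le by (subst prod.insert) (simp_all add: inner_axis axis_eq_axis ennreal_mult)
  qed
  finally show "emeasure (distr (lborel \<Otimes>\<^sub>M lborel) borel (\<lambda>(x, y). vector [x, y] :: real^2)) (box a b) = ennreal (\<Prod>i\<in>Basis. (b - a) \<bullet> i)" .
qed simp

lemma nn_integral_lborel_2:
  assumes [measurable]: "f \<in> borel_measurable (borel :: (real^2) measure)"
  shows "(\<integral>\<^sup>+z. f z \<partial>lborel) = (\<integral>\<^sup>+x. \<integral>\<^sup>+y. f (vector [x, y]) \<partial>lborel \<partial>lborel)"
proof -
  have meas[measurable]: "(\<lambda>(x, y). vector [x, y] :: real^2) \<in> lborel \<Otimes>\<^sub>M lborel \<rightarrow>\<^sub>M borel"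
    unfolding vector_2_eq by measurable
  have "(\<integral>\<^sup>+z. f z \<partial>lborel) = (\<integral>\<^sup>+z. f z \<partial>distr (lborel \<Otimes>\<^sub>M lborel) borel (\<lambda>(x, y). vector [x, y] :: real^2))"
    by (simp add: lborel_2)
  also have "\<dots> = (\<integral>\<^sup>+p. f (case p of (x, y) \<Rightarrow> vector [x, y]) \<partial>(lborel \<Otimes>\<^sub>M lborel))"
    by (subst nn_integral_distr) auto
  also have "\<dots> = (\<integral>\<^sup>+x. \<integral>\<^sup>+y. f (vector [x, y]) \<partial>lborel \<partial>lborel)"
    by (subst lborel.nn_integral_fst[symmetric]) auto
  finally show ?thesis .
qed

text \<open>
  The vectors \<open>l1\<close> and \<open>l2\<close> are the rows of the inverse of the Cholesky factor. Triangularity allows the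
  change of variables to be made in one coordinate at a time.
\<close>

lemma cholesky_gaussian_density:
  fixes S :: "real^2^2"
  assumes pos: "S$1$1 > 0" and less: "(S$1$2)\<^sup>2 < S$1$1 * S$2$2"
  obtains K c l1 l2 where "K \<ge> 0" "c > 0" "\<And>z. c * (norm z)\<^sup>2 \<le> ((l1 \<bullet> z)\<^sup>2 + (l2 \<bullet> z)\<^sup>2) / 2"
    "cholesky_gaussian 0 S = density lborel (\<lambda>z. K * exp (- ((l1 \<bullet> z)\<^sup>2 + (l2 \<bullet> z)\<^sup>2) / 2))"
proof -
  define a b e where "a = sqrt (S$1$1)" and "b = S$1$2 / sqrt (S$1$1)"
    and "e = sqrt (S$2$2 - (S$1$2)\<^sup>2 / S$1$1)"
  have ae: "a > 0" "e > 0" using pos less by (auto simp: a_def e_def field_simps)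
  define l1 l2 :: "real^2" where "l1 = vector [1 / a, 0]" and "l2 = vector [- (b / (a * e)), 1 / e]"
  define K where "K = 1 / (2 * pi * a * e)"
  define M where "M = a\<^sup>2 + 2 * b\<^sup>2 + 2 * e\<^sup>2"
  have M: "M > 0" using ae by (auto simp: M_def intro!: add_pos_nonneg)
  let ?g = "\<lambda>z. K * exp (- ((l1 \<bullet> z)\<^sup>2 + (l2 \<bullet> z)\<^sup>2) / 2)"
  have l: "l1 \<bullet> vector [a * x, b * x + e * y] = x" "l2 \<bullet> vector [a * x, b * x + e * y] = y" for x y
    using ae by (simp_all add: l1_def l2_def inner_2 field_simps)
  let ?N = std_normal_distribution
  interpret N: prob_space ?N by (rule prob_space_normal_density) simp
  have chol: "x *\<^sub>R cholesky1 S + y *\<^sub>R cholesky2 S = vector [a * x, b * x + e * y]" for x y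
    by (simp add: cholesky1_def cholesky2_def a_def b_def e_def vec_eq_iff forall_2)
  have vm[measurable (raw)]: "(\<lambda>p. vector [f p, g p] :: real^2) \<in> L \<rightarrow>\<^sub>M borel"
    if [measurable]: "f \<in> borel_measurable L" "g \<in> borel_measurable L" for f g and L :: "'z measure"
    unfolding vector_2_eq by measurable
  have dens: "cholesky_gaussian 0 S = density lborel (\<lambda>z. ennreal (?g z))"
  proof (rule measure_eqI)
    fix A assume "A \<in> sets (cholesky_gaussian 0 S)"
    then have A[measurable]: "A \<in> sets borel" by (simp add: cholesky_gaussian_def)
    have "emeasure (density lborel (\<lambda>z. ennreal (?g z))) A = (\<integral>\<^sup>+z. ennreal (?g z) * indicator A z \<partial>lborel)"
      by (rule emeasure_density) auto
    also have "\<dots> = (\<integral>\<^sup>+x. \<integral>\<^sup>+y. ennreal (?g (vector [x, y])) * indicator A (vector [x, y]) \<partial>lborel \<partial>lborel)"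
      by (rule nn_integral_lborel_2) auto
    also have "\<dots> = a * (\<integral>\<^sup>+x. \<integral>\<^sup>+y. ennreal (?g (vector [a * x, y])) * indicator A (vector [a * x, y]) \<partial>lborel \<partial>lborel)"
      using ae by (subst nn_integral_real_affine[where c=a and t=0]) auto
    also have "\<dots> = a * (\<integral>\<^sup>+x. e * (\<integral>\<^sup>+y. ennreal (?g (vector [a * x, b * x + e * y])) * indicator A (vector [a * x, b * x + e * y]) \<partial>lborel) \<partial>lborel)"
    proof -
      have "(\<integral>\<^sup>+y. ennreal (?g (vector [a * x, y])) * indicator A (vector [a * x, y]) \<partial>lborel) =
          e * (\<integral>\<^sup>+y. ennreal (?g (vector [a * x, b * x + e * y])) * indicator A (vector [a * x, b * x + e * y]) \<partial>lborel)" for x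
        using ae by (subst nn_integral_real_affine[where c=e and t="b * x"]) auto
      then show ?thesis by simp
    qed
    also have "\<dots> = (\<integral>\<^sup>+x. \<integral>\<^sup>+y. ennreal (a * e * ?g (vector [a * x, b * x + e * y])) * indicator A (vector [a * x, b * x + e * y]) \<partial>lborel \<partial>lborel)"
    proof -
      let ?h = "\<lambda>x y. ennreal (?g (vector [a * x, b * x + e * y])) * indicator A (vector [a * x, b * x + e * y])"
      have "(\<integral>\<^sup>+y. ennreal (a * e * ?g (vector [a * x, b * x + e * y])) * indicator A (vector [a * x, b * x + e * y]) \<partial>lborel) =
          (\<integral>\<^sup>+y. ennreal (a * e) * ?h x y \<partial>lborel)" for x
        using ae by (intro nn_integral_cong) (subst ennreal_mult', auto simp: mult.assoc)
      also have "(\<integral>\<^sup>+y. ennreal (a * e) * ?h x y \<partial>lborel) = a * (e * (\<integral>\<^sup>+y. ?h x y \<partial>lborel))" for x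
        using ae by (subst nn_integral_cmult) (auto simp: ennreal_mult mult.assoc)
      finally show ?thesis
        by (simp only:) (rule nn_integral_cmult[symmetric], measurable)
    qed
    also have "\<dots> = (\<integral>\<^sup>+x. \<integral>\<^sup>+y. ennreal (std_normal_density x) * (ennreal (std_normal_density y) * indicator A (vector [a * x, b * x + e * y])) \<partial>lborel \<partial>lborel)"
    proof (intro nn_integral_cong)
      fix x y :: real
      have "exp (- (x\<^sup>2 + y\<^sup>2) / 2) = exp (- x\<^sup>2 / 2) * exp (- y\<^sup>2 / 2)"
        by (simp add: diff_divide_distrib flip: exp_add)
      then have "a * e * ?g (vector [a * x, b * x + e * y]) = std_normal_density x * std_normal_density y"
        using ae by (simp add: l K_def std_normal_density_def)
      then show "ennreal (a * e * ?g (vector [a * x, b * x + e * y])) * indicator A (vector [a * x, b * x + e * y]) =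
          ennreal (std_normal_density x) * (ennreal (std_normal_density y) * indicator A (vector [a * x, b * x + e * y]))"
        by (simp add: ennreal_mult mult.assoc)
    qed
    also have "\<dots> = (\<integral>\<^sup>+x. \<integral>\<^sup>+y. indicator A (vector [a * x, b * x + e * y]) \<partial>?N \<partial>?N)"
      by (simp add: nn_integral_density nn_integral_cmult)
    also have "\<dots> = (\<integral>\<^sup>+p. indicator A ((\<lambda>(x, y). (0 + x *\<^sub>R cholesky1 S) + y *\<^sub>R cholesky2 S) p) \<partial>(?N \<Otimes>\<^sub>M ?N))"
      by (subst N.nn_integral_fst[symmetric]) (auto simp: chol)
    also have "\<dots> = emeasure (cholesky_gaussian 0 S) A"
      unfolding cholesky_gaussian_def
      by (subst nn_integral_distr[symmetric, where M'=borel]) auto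
    finally show "emeasure (cholesky_gaussian 0 S) A = emeasure (density lborel (\<lambda>z. ennreal (?g z))) A" ..
  qed (simp add: cholesky_gaussian_def)
  have coer: "1 / (2 * M) * (norm z)\<^sup>2 \<le> ((l1 \<bullet> z)\<^sup>2 + (l2 \<bullet> z)\<^sup>2) / 2" for z
  proof -
    let ?p = "l1 \<bullet> z" and ?q = "l2 \<bullet> z"
    have z: "z$1 = a * ?p" "z$2 = b * ?p + e * ?q"
      using ae by (simp_all add: l1_def l2_def inner_2 field_simps)
    have "(norm z)\<^sup>2 = (z$1)\<^sup>2 + (z$2)\<^sup>2"
      by (simp only: power2_norm_eq_inner inner_2) (simp add: power2_eq_square)
    also have "\<dots> = (a * ?p)\<^sup>2 + (b * ?p + e * ?q)\<^sup>2"
      by (simp only: z)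
    also have "\<dots> \<le> (a * ?p)\<^sup>2 + (2 * (b * ?p)\<^sup>2 + 2 * (e * ?q)\<^sup>2)"
      using sum_squares_bound[of "b * ?p" "e * ?q"] by (simp add: power2_sum)
    also have "\<dots> \<le> M * (?p\<^sup>2 + ?q\<^sup>2)"
      by (simp add: M_def power_mult_distrib algebra_simps)
    finally show ?thesis using M by (simp add: field_simps)
  qed
  show thesis
    by (rule that[OF _ _ coer dens]) (use ae M in \<open>auto simp: K_def\<close>)
qed

text \<open>
  The product form of the characteristic function says that \<open>\<mu>\<close> is the law of \<open>E w + x\<close> for
  independent \<open>w\<close> with law \<open>\<pi>\<close> and \<open>x\<close> centred Gaussian with covariance \<open>S\<close>. All the
  regularity comes from the Gaussian factor, so \<open>\<pi>\<close> may be singular.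
\<close>

lemma has_smooth_density_if_mchar:
  fixes \<mu> \<pi> :: "(real^2) measure" and E S :: "real^2^2"
  assumes \<mu>: "prob_space \<mu>" "sets \<mu> = sets borel" and \<pi>: "prob_space \<pi>" "sets \<pi> = sets borel"
    and sym: "transpose S = S" and pos: "S$1$1 > 0" and less: "(S$1$2)\<^sup>2 < S$1$1 * S$2$2"
    and eq: "\<And>u. mchar \<mu> u = mchar \<pi> (transpose E *v u) * exp (- (u \<bullet> (S *v u)) / 2)"
  shows "has_smooth_density \<mu>"
proof -
  have [measurable_cong]: "sets \<pi> = sets borel" by fact
  obtain K c l1 l2 where K: "K \<ge> 0" and c: "c > 0" "\<And>z. c * (norm z)\<^sup>2 \<le> ((l1 \<bullet> z)\<^sup>2 + (l2 \<bullet> z)\<^sup>2) / 2"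
    and dens: "cholesky_gaussian 0 S = density lborel (\<lambda>z. K * exp (- ((l1 \<bullet> z)\<^sup>2 + (l2 \<bullet> z)\<^sup>2) / 2))"
    using cholesky_gaussian_density[OF pos less] by blast
  define g where "g = (\<lambda>z. K * exp (- ((l1 \<bullet> z)\<^sup>2 + (l2 \<bullet> z)\<^sup>2) / 2))"
  have g0: "0 \<le> g z" for z using K by (simp add: g_def)
  have gp: "poly_exp l1 l2 g" unfolding g_def by (intro poly_exp.intros)
  have gm[measurable]: "g \<in> borel_measurable borel" unfolding g_def by measurable
  let ?G = "cholesky_gaussian 0 S"
  have G: "gaussian 0 S ?G" using less by (intro gaussian_cholesky_gaussian[OF sym pos]) simp
  have [measurable_cong]: "sets ?G = sets borel" by (simp add: cholesky_gaussian_def)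
  have GD: "?G = density lborel g" using dens by (simp add: g_def)
  have Em[measurable]: "(\<lambda>z. E *v z) \<in> borel_measurable borel"
    by (intro borel_measurable_continuous_onI linear_continuous_on matrix_vector_mul_bounded_linear)
  interpret PI: prob_space \<pi> by fact
  interpret G: prob_space ?G using G by (simp add: gaussian_def)
  interpret pair: pair_prob_space \<pi> ?G ..
  interpret L: pair_sigma_finite \<pi> lborel ..
  let ?\<nu> = "distr (\<pi> \<Otimes>\<^sub>M ?G) borel (\<lambda>(z, w). E *v z + w)"
  have meas[measurable]: "(\<lambda>(z, w). E *v z + w) \<in> borel_measurable (\<pi> \<Otimes>\<^sub>M ?G)"
    by measurable
  have "\<mu> = ?\<nu>"
  proof (rule mchar_unique_2)
    show "finite_measure ?\<nu>"
      using pair.P.prob_space_distr[OF meas] by (rule prob_space.finite_measure)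
    fix u
    have "mchar ?\<nu> u = (CLINT z|\<pi>. iexp (u \<bullet> (E *v z))) * mchar ?G u"
      unfolding mchar_def[of ?G] by (rule mchar_pair_add[OF PI.prob_space_axioms G.prob_space_axioms]) measurable
    also have "(CLINT z|\<pi>. iexp (u \<bullet> (E *v z))) = mchar \<pi> (transpose E *v u)"
      by (simp add: mchar_def dot_lmul_matrix)
    finally show "mchar \<mu> u = mchar ?\<nu> u"
      by (simp add: eq gaussian_mchar[OF G])
  qed (use \<mu> in \<open>auto intro: prob_space.finite_measure\<close>)
  also have "?\<nu> = density lborel (\<lambda>z. ennreal (\<integral>w. g (z - E *v w) \<partial>\<pi>))"
  proof (rule measure_eqI)
    fix A assume "A \<in> sets ?\<nu>"
    then have A[measurable]: "A \<in> sets borel" by simp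
    have "emeasure ?\<nu> A = (\<integral>\<^sup>+p. indicator A ((\<lambda>(z, w). E *v z + w) p) \<partial>(\<pi> \<Otimes>\<^sub>M ?G))"
      by (subst nn_integral_distr[symmetric, where M'=borel]) auto
    also have "\<dots> = (\<integral>\<^sup>+w. \<integral>\<^sup>+x. indicator A (E *v w + x) \<partial>?G \<partial>\<pi>)"
      by (subst G.nn_integral_fst[symmetric]) auto
    also have "\<dots> = (\<integral>\<^sup>+w. \<integral>\<^sup>+x. ennreal (g x) * indicator A (E *v w + x) \<partial>lborel \<partial>\<pi>)"
      unfolding GD by (simp add: nn_integral_density)
    also have "\<dots> = (\<integral>\<^sup>+w. \<integral>\<^sup>+z. ennreal (g (z - E *v w)) * indicator A z \<partial>lborel \<partial>\<pi>)"
    proof (rule nn_integral_cong)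
      fix w
      have "(\<integral>\<^sup>+z. ennreal (g (z - E *v w)) * indicator A z \<partial>lborel) =
          (\<integral>\<^sup>+z. ennreal (g (z - E *v w)) * indicator A z \<partial>distr lborel borel ((+) (E *v w)))"
        by (simp add: lborel_distr_plus)
      also have "\<dots> = (\<integral>\<^sup>+x. ennreal (g x) * indicator A (E *v w + x) \<partial>lborel)"
        by (subst nn_integral_distr) auto
      finally show "(\<integral>\<^sup>+x. ennreal (g x) * indicator A (E *v w + x) \<partial>lborel) =
        (\<integral>\<^sup>+z. ennreal (g (z - E *v w)) * indicator A z \<partial>lborel)" ..
    qed
    also have "\<dots> = (\<integral>\<^sup>+z. \<integral>\<^sup>+w. ennreal (g (z - E *v w)) * indicator A z \<partial>\<pi> \<partial>lborel)"
      by (rule L.Fubini'[symmetric]) measurable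
    also have "\<dots> = (\<integral>\<^sup>+z. ennreal (\<integral>w. g (z - E *v w) \<partial>\<pi>) * indicator A z \<partial>lborel)"
    proof (rule nn_integral_cong)
      fix z
      obtain B where B: "\<And>z. \<bar>g z\<bar> \<le> B" using poly_exp_bounded[OF gp c] by blast
      have "integrable \<pi> (\<lambda>w. g (z - E *v w))"
        by (rule PI.integrable_const_bound[where B=B]) (use B in auto)
      then show "(\<integral>\<^sup>+w. ennreal (g (z - E *v w)) * indicator A z \<partial>\<pi>) = ennreal (\<integral>w. g (z - E *v w) \<partial>\<pi>) * indicator A z"
        using g0 by (simp add: nn_integral_multc nn_integral_eq_integral)
    qed
    also have "\<dots> = emeasure (density lborel (\<lambda>z. ennreal (\<integral>w. g (z - E *v w) \<partial>\<pi>))) A"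
      by (rule emeasure_density[symmetric]) auto
    finally show "emeasure ?\<nu> A = emeasure (density lborel (\<lambda>z. ennreal (\<integral>w. g (z - E *v w) \<partial>\<pi>))) A" .
  qed simp
  finally have eq: "\<mu> = density lborel (\<lambda>z. ennreal (\<integral>w. g (z - E *v w) \<partial>\<pi>))" .
  have "smooth (\<lambda>z. \<integral>w. g (z - E *v w) \<partial>\<pi>)"
    by (rule smooth_convolution_poly_exp[OF _ _ c gp]) (auto intro: prob_space.finite_measure \<pi>)
  then show ?thesis
    unfolding has_smooth_density_def using eq g0 by (intro exI[of _ "\<lambda>z. \<integral>w. g (z - E *v w) \<partial>\<pi>"]) auto
qed

section \<open>The primal-dual Langevin diffusion\<close>

lemma tendsto_moebius:
  fixes \<alpha> \<beta> \<gamma> :: real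
  assumes "\<gamma> > 0"
  shows "((\<lambda>r. (\<alpha> + \<beta> * r) / (1 + \<gamma> * r)) \<longlongrightarrow> \<beta> / \<gamma>) at_top"
  using assms by real_asymp (simp add: divide_inverse)

lemma drift_matrix_simps [simp]:
  "drift_matrix k cg cf l $ 1 $ 1 = inverse cg" "drift_matrix k cg cf l $ 1 $ 2 = k"
  "drift_matrix k cg cf l $ 2 $ 1 = - l * k" "drift_matrix k cg cf l $ 2 $ 2 = l * cf"
  by (simp_all add: drift_matrix_def)

lemma stationary_covariance_simps:
  "stationary_covariance k cg cf r $ 1 $ 1 = (cg * (cf + k\<^sup>2 * cg) + r * cf\<^sup>2 * cg\<^sup>2) / ((cf + k\<^sup>2 * cg) * (1 + r * cf * cg))"
  "stationary_covariance k cg cf r $ 1 $ 2 = k * r * cf * cg\<^sup>2 / ((cf + k\<^sup>2 * cg) * (1 + r * cf * cg))"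
  "stationary_covariance k cg cf r $ 2 $ 1 = k * r * cf * cg\<^sup>2 / ((cf + k\<^sup>2 * cg) * (1 + r * cf * cg))"
  "stationary_covariance k cg cf r $ 2 $ 2 = k\<^sup>2 * r * cg\<^sup>2 / ((cf + k\<^sup>2 * cg) * (1 + r * cf * cg))"
  by (simp_all add: stationary_covariance_def)

lemma transpose_stationary_covariance: "transpose (stationary_covariance k cg cf r) = stationary_covariance k cg cf r"
  by (simp add: transpose_2 stationary_covariance_simps)

lemma lyapunov_stationary_covariance:
  assumes "cg > 0" "cf > 0" "r > 0"
  shows "2 * ((transpose (drift_matrix k cg cf r) *v u) \<bullet> (stationary_covariance k cg cf r *v u)) = (u \<bullet> noise_vector)\<^sup>2"
proof -
  let ?S = "stationary_covariance k cg cf r"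
  define D where "D = (cf + k\<^sup>2 * cg) * (1 + r * cf * cg)"
  have "D > 0" using assms by (auto simp: D_def intro!: mult_pos_pos add_pos_nonneg)
  then have D: "D \<noteq> 0" by simp
  note s = stationary_covariance_simps[of k cg cf r, folded D_def]
  have l11: "inverse cg * ?S$1$1 + k * ?S$1$2 = 1"
    using assms D unfolding s by (simp add: field_simps) (simp add: D_def power2_eq_square algebra_simps)
  have l12: "inverse cg * ?S$1$2 + k * ?S$2$2 - r * k * ?S$1$1 + r * cf * ?S$1$2 = 0"
    using assms D unfolding s by (simp add: field_simps) (simp add: power2_eq_square algebra_simps)
  have l22: "- r * k * ?S$1$2 + r * cf * ?S$2$2 = 0"
    using assms D unfolding s by (simp add: field_simps power2_eq_square)
  have s21: "?S$2$1 = ?S$1$2" by (simp add: s)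
  have "(transpose (drift_matrix k cg cf r) *v u) \<bullet> (?S *v u) =
      (u$1)\<^sup>2 * (inverse cg * ?S$1$1 + k * ?S$1$2) +
      u$1 * u$2 * (inverse cg * ?S$1$2 + k * ?S$2$2 - r * k * ?S$1$1 + r * cf * ?S$1$2) +
      (u$2)\<^sup>2 * (- r * k * ?S$1$2 + r * cf * ?S$2$2)"
    by (simp add: inner_2 vector_matrix_mult_def matrix_vector_mult_def transpose_def sum_2 s21 power2_eq_square algebra_simps)
  also have "\<dots> = (u$1)\<^sup>2" unfolding l11 l12 l22 by simp
  finally show ?thesis by (simp add: noise_vector_def inner_2 power_mult_distrib)
qed

lemma stationary_covariance_posdef:
  assumes "k \<noteq> 0" "cg > 0" "cf > 0" "r > 0"
  shows "stationary_covariance k cg cf r $ 1 $ 1 > 0"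
    "(stationary_covariance k cg cf r $ 1 $ 2)\<^sup>2 < stationary_covariance k cg cf r $ 1 $ 1 * stationary_covariance k cg cf r $ 2 $ 2"
proof -
  define P where "P = cf + k\<^sup>2 * cg"
  define D where "D = P * (1 + r * cf * cg)"
  have P: "P > 0" using assms by (auto simp: P_def intro!: add_pos_nonneg)
  have D: "D > 0" using assms P by (auto simp: D_def intro!: mult_pos_pos add_pos_nonneg)
  note s = stationary_covariance_simps[of k cg cf r, folded P_def, folded D_def]
  show "stationary_covariance k cg cf r $ 1 $ 1 > 0"
    unfolding s using assms P D by (auto intro!: divide_pos_pos add_pos_pos mult_pos_pos)
  have "(k * r * cf * cg\<^sup>2)\<^sup>2 < (cg * P + r * cf\<^sup>2 * cg\<^sup>2) * (k\<^sup>2 * r * cg\<^sup>2)"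
  proof -
    have "0 < cg * P * (k\<^sup>2 * r * cg\<^sup>2)" using assms P by simp
    then show ?thesis by (simp add: power2_eq_square algebra_simps)
  qed
  then have "(k * r * cf * cg\<^sup>2)\<^sup>2 / D\<^sup>2 < (cg * P + r * cf\<^sup>2 * cg\<^sup>2) * (k\<^sup>2 * r * cg\<^sup>2) / D\<^sup>2"
    using D by (intro divide_strict_right_mono) auto
  then show "(stationary_covariance k cg cf r $ 1 $ 2)\<^sup>2 < stationary_covariance k cg cf r $ 1 $ 1 * stationary_covariance k cg cf r $ 2 $ 2"
    unfolding s by (simp add: power_divide power2_eq_square)
qed

lemma drift_flow:
  assumes "k \<noteq> 0" "cg > 0" "cf > 0" "r > 0"
  obtains E where "stable_linear_sde (drift_matrix k cg cf r) (stationary_covariance k cg cf r) noise_vector E"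
    "(E \<longlongrightarrow> 0) at_top"
proof -
  let ?A = "drift_matrix k cg cf r"
  have "?A$1$1 + ?A$2$2 > 0" using assms by (auto intro!: add_pos_pos)
  moreover have "det ?A = r * (inverse cg * cf + k\<^sup>2)"
    by (simp add: det_2 power2_eq_square algebra_simps)
  then have "det ?A > 0" using assms by (auto intro!: mult_pos_pos add_pos_pos)
  ultimately obtain E where E: "E 0 = mat 1" "\<And>s. (E has_vector_derivative - (E s ** ?A)) (at s)" "(E \<longlongrightarrow> 0) at_top"
    using stable_matrix_flow[of ?A] by blast
  show thesis
    by (rule that[of E]; (rule stable_linear_sde.intro)?)
       (use E transpose_stationary_covariance lyapunov_stationary_covariance assms in auto)
qed

text \<open>
  The first condition kills the first component of \<open>v\<close>, and then the second kills the other, since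
  the coupling entry \<open>- l k\<close> of the drift is nonzero.
\<close>

lemma drift_noise_controllable:
  assumes "k \<noteq> 0" "l > 0" "v \<bullet> noise_vector = 0" "v \<bullet> (drift_matrix k cg cf l *v noise_vector) = 0"
  shows "v = 0"
  using assms by (auto simp: noise_vector_def inner_2 matrix_vector_mult_def sum_2 vec_eq_iff forall_2)

lemma stationary_covariance_tendsto:
  assumes "cg > 0" "cf > 0"
  shows "((\<lambda>r. stationary_covariance k cg cf r) \<longlongrightarrow>
    (cf * cg / (cf + k\<^sup>2 * cg)) *\<^sub>R vector [vector [1, k / cf], vector [k / cf, (k / cf)\<^sup>2]]) at_top"
proof -
  define P where "P = cf + k\<^sup>2 * cg"
  have P: "P > 0" using assms by (auto simp: P_def intro!: add_pos_nonneg)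
  have c: "cf * cg > 0" using assms by simp
  note s = stationary_covariance_simps[of k cg cf, folded P_def]
  have lim: "((\<lambda>r. (\<alpha> + \<beta> * r) / (P * (1 + r * cf * cg))) \<longlongrightarrow> \<beta> / (cf * cg) / P) at_top" for \<alpha> \<beta>
    using tendsto_divide[OF tendsto_moebius[OF c, of \<alpha> \<beta>] tendsto_const[of P]] P
    by (simp add: mult.commute mult.left_commute)
  show ?thesis
    unfolding P_def[symmetric]
  proof (intro vec_tendstoI, goal_cases)
    case (1 i j)
    have "i = 1 \<or> i = 2" "j = 1 \<or> j = 2" using exhaust_2 by auto
    then show ?case
      using lim[of "cg * P" "cf\<^sup>2 * cg\<^sup>2"] lim[of 0 "k * cf * cg\<^sup>2"] lim[of 0 "k\<^sup>2 * cg\<^sup>2"] assms P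
      by (auto simp: s field_simps power2_eq_square)
  qed
qed

theorem theorem3p5:
  fixes k cg cf l :: real
    and f g h :: "real \<Rightarrow> real"
    and \<mu> :: "real measure"
    and \<nu> :: "(real ^ 2) measure"
  assumes "k \<noteq> 0" and "cg > 0" and "cf > 0" and "l > 0"
    and f: "f = (\<lambda>y. 1 / (2 * cf) * y\<^sup>2)"
    and g: "g = (\<lambda>x. 1 / (2 * cg) * x\<^sup>2)"
    and h: "h = (\<lambda>x. f (k * x) + g x)"
    and \<mu>: "\<mu> = gibbs_measure h"
    and \<nu>: "\<nu> = distr \<mu> borel (\<lambda>x. vector [x, deriv f (k * x)])"
  shows
    "(\<forall>x. h x = (k\<^sup>2 * cg + cf) / (2 * cf * cg) * x\<^sup>2) \<and> prob_space \<mu> \<and>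
     (\<forall>(M :: 'a measure) F W Z.
        linear_sde_solution (drift_matrix k cg cf l) noise_vector M F W Z \<longrightarrow>
        (\<forall>t>0. has_smooth_density (distr M borel (Z t)))) \<and>
     (\<forall>(M :: 'a measure) F W Z.
        linear_sde_solution (drift_matrix k cg cf l) noise_vector M F W Z \<and>
        is_gaussian (distr M borel (Z 0)) \<longrightarrow>
        (\<forall>t>0. nondegenerate_gaussian (distr M borel (Z t)))) \<and>
     (\<exists>\<pi> :: real \<Rightarrow> (real ^ 2) measure.
        (\<forall>r>0. gaussian 0 (stationary_covariance k cg cf r) (\<pi> r)) \<and>
        (\<forall>(M :: 'a measure) F W Z.
           linear_sde_solution (drift_matrix k cg cf l) noise_vector M F W Z \<and>
           distr M borel (Z 0) = \<pi> l \<longrightarrow>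
           (\<forall>t\<ge>0. distr M borel (Z t) = \<pi> l)) \<and>
        (\<forall>(M :: 'a measure) F W Z.
           linear_sde_solution (drift_matrix k cg cf l) noise_vector M F W Z \<and>
           is_gaussian (distr M borel (Z 0)) \<longrightarrow>
           weakly_converges (\<lambda>t. distr M borel (Z t)) (\<pi> l) at_top) \<and>
        distr (\<pi> l) borel (\<lambda>z. z $ 1) \<noteq> \<mu> \<and>
        weakly_converges \<pi> \<nu> at_top) \<and>
     degenerate_gaussian \<nu> \<and>
     distr \<nu> borel (\<lambda>z. z $ 1) = \<mu>"
proof -
  let ?A = "drift_matrix k cg cf l" and ?B = noise_vector and ?S = "stationary_covariance k cg cf"
  define v where "v = cf * cg / (cf + k\<^sup>2 * cg)"
  have P: "cf + k\<^sup>2 * cg > 0" using assms(2,3) by (auto intro!: add_pos_nonneg)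
  then have v: "v > 0" using assms(2,3) by (simp add: v_def)
  note params = assms(1-4)
  have quad: "h x = (k\<^sup>2 * cg + cf) / (2 * cf * cg) * x\<^sup>2" for x
    using assms(2,3) by (simp add: h f g field_simps power2_eq_square)
  have "h = (\<lambda>x. x\<^sup>2 / (2 * v))"
    using P assms(2,3) by (auto simp: quad v_def field_simps)
  then have \<mu>_law: "\<mu> = normal_law 0 v" using v by (simp add: \<mu> gibbs_measure_quadratic)
  have \<mu>_prob: "prob_space \<mu>"
    using real_distribution_normal_law[of v] v by (simp add: \<mu>_law real_distribution_def)
  have "deriv f (k * x) = k / cf * x" for x
    unfolding f by (rule DERIV_imp_deriv) (use assms(3) in \<open>auto intro!: derivative_eq_intros simp: field_simps\<close>)
  then have \<nu>_law: "\<nu> = distr (normal_law 0 v) borel (\<lambda>x. vector [x, k / cf * x])"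
    by (simp add: \<nu> \<mu>_law)
  define S\<nu> :: "real^2^2" where "S\<nu> = v *\<^sub>R vector [vector [1, k / cf], vector [k / cf, (k / cf)\<^sup>2]]"
  have \<nu>_gaussian: "gaussian 0 S\<nu> \<nu>"
    unfolding \<nu>_law S\<nu>_def using v by (intro gaussian_graph) simp
  have \<nu>_sing: "\<not> invertible S\<nu>"
    by (simp add: invertible_det_nz S\<nu>_def det_2 power2_eq_square)
  have \<nu>_marginal: "distr \<nu> borel (\<lambda>z. z $ 1) = \<mu>"
  proof -
    have "(\<lambda>x. vector [x, k / cf * x] :: real^2) \<in> normal_law 0 v \<rightarrow>\<^sub>M borel"
      using real_distribution.events_eq_borel[OF real_distribution_normal_law[of v 0]] v
      unfolding vector_2_eq by (intro borel_measurable_add borel_measurable_scaleR) (auto simp: measurable_def)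
    then have "distr \<nu> borel (\<lambda>z. z $ 1) = distr \<mu> borel (\<lambda>x. x)"
      unfolding \<nu>_law \<mu>_law by (subst distr_distr) (auto simp: comp_def)
    also have "\<dots> = \<mu>"
      using real_distribution.events_eq_borel[OF real_distribution_normal_law[of v 0]] v
      by (intro distr_id2) (simp add: \<mu>_law)
    finally show ?thesis .
  qed
  define \<pi> where "\<pi> r = cholesky_gaussian 0 (?S r)" for r
  have \<pi>: "gaussian 0 (?S r) (\<pi> r)" if "r > 0" for r
    unfolding \<pi>_def using stationary_covariance_posdef[of k cg cf r] params that
    by (intro gaussian_cholesky_gaussian transpose_stationary_covariance) auto
  obtain E where E: "stable_linear_sde ?A (?S l) ?B E" "(E \<longlongrightarrow> 0) at_top"
    using drift_flow[OF params] by blast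
  interpret stable_linear_sde ?A "?S l" ?B E by (rule E(1))
  have pos: "0 < u \<bullet> (cov t *v u)" if "t > 0" "u \<noteq> 0" for t u
    using that params by (intro inner_cov_pos drift_noise_controllable) auto
  have smooth: "has_smooth_density (distr M borel (Z t))"
    if sol: "linear_sde_solution ?A ?B M F W Z" and t: "t > 0" for M :: "'a measure" and F W Z t
  proof (rule has_smooth_density_if_mchar)
    have "Z s \<in> borel_measurable M" if "s \<ge> 0" for s
      using sol that by (auto simp: linear_sde_solution_def brownian_motion_def intro: measurable_from_subalg)
    moreover have "prob_space M" using sol by (simp add: linear_sde_solution_def brownian_motion_def)
    ultimately show "prob_space (distr M borel (Z t))" "prob_space (distr M borel (Z 0))"
      using t by (auto intro: prob_space.prob_space_distr)
    show "transpose (cov t) = cov t" by (rule transpose_cov)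
    then show "cov t $ 1 $ 1 > 0" "(cov t $ 1 $ 2)\<^sup>2 < cov t $ 1 $ 1 * cov t $ 2 $ 2"
      using posdef_2[of "cov t"] pos[OF t] by auto
    show "mchar (distr M borel (Z t)) u =
        mchar (distr M borel (Z 0)) (transpose (E t) *v u) * exp (- (u \<bullet> (cov t *v u)) / 2)" for u
      using mchar_solution[OF sol, of t u] t by simp
  qed simp_all
  have nondeg: "nondegenerate_gaussian (distr M borel (Z t))"
    if sol: "linear_sde_solution ?A ?B M F W Z" and g: "is_gaussian (distr M borel (Z 0))" and t: "t > 0"
    for M :: "'a measure" and F W Z t
  proof -
    obtain m S0 where g: "gaussian m S0 (distr M borel (Z 0))" using g by (auto simp: is_gaussian_def)
    have "invertible (E t ** S0 ** transpose (E t) + cov t)"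
    proof (rule invertible_if_posdef)
      fix u :: "real^2" assume "u \<noteq> 0"
      then show "0 < u \<bullet> ((E t ** S0 ** transpose (E t) + cov t) *v u)"
        unfolding matrix_vector_mult_add_rdistrib inner_add_right quadratic_conjugate
        using g pos[OF t] by (auto simp: gaussian_def intro!: add_nonneg_pos)
    qed
    then show ?thesis
      using gaussian_solution[OF sol _ g, of t] t by (auto simp: nondegenerate_gaussian_def)
  qed
  have stationary: "distr M borel (Z t) = \<pi> l"
    if sol: "linear_sde_solution ?A ?B M F W Z" and init: "distr M borel (Z 0) = \<pi> l" and t: "t \<ge> 0"
    for M :: "'a measure" and F W Z t
  proof (rule gaussian_unique)
    show "gaussian 0 (?S l) (distr M borel (Z t))"
      by (rule gaussian_solution_stationary[OF sol t]) (use init \<pi> params in simp)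
    show "gaussian 0 (?S l) (\<pi> l)" using \<pi> params by simp
  qed
  have ergodic: "weakly_converges (\<lambda>t. distr M borel (Z t)) (\<pi> l) at_top"
    if sol: "linear_sde_solution ?A ?B M F W Z" and g: "is_gaussian (distr M borel (Z 0))"
    for M :: "'a measure" and F W Z
  proof -
    obtain m S0 where g: "gaussian m S0 (distr M borel (Z 0))" using g by (auto simp: is_gaussian_def)
    show ?thesis
    proof (rule gaussian_weakly_converges)
      show "\<forall>\<^sub>F t in at_top. gaussian (E t *v m) (E t ** S0 ** transpose (E t) + cov t) (distr M borel (Z t))"
        using eventually_ge_at_top[of 0] by eventually_elim (rule gaussian_solution[OF sol _ g])
      show "gaussian 0 (?S l) (\<pi> l)" "?S l $ 1 $ 1 > 0"
        using \<pi> params stationary_covariance_posdef by auto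
      show "((\<lambda>t. E t *v m) \<longlongrightarrow> 0) at_top" by (rule tendsto_flow_vector[OF E(2)])
      from tendsto_add[OF tendsto_conjugate[OF E(2), of S0] tendsto_diff[OF tendsto_const[of "?S l"] tendsto_conjugate[OF E(2), of "?S l"]]]
      show "((\<lambda>t. E t ** S0 ** transpose (E t) + cov t) \<longlongrightarrow> ?S l) at_top"
        by (simp add: cov_def)
    qed
  qed
  have neq: "distr (\<pi> l) borel (\<lambda>z. z $ 1) \<noteq> \<mu>"
  proof
    assume eq: "distr (\<pi> l) borel (\<lambda>z. z $ 1) = \<mu>"
    have "distr (\<pi> l) borel (\<lambda>z. axis 1 1 \<bullet> z) = normal_law 0 (axis 1 1 \<bullet> (?S l *v axis 1 1))"
      using \<pi>[of l] params by (simp add: gaussian_def)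
    moreover have "axis 1 1 \<bullet> (?S l *v axis 1 1) = ?S l $ 1 $ 1"
      by (simp add: inner_mult_2 axis_def)
    ultimately have "normal_law 0 (?S l $ 1 $ 1) = normal_law 0 v"
      using eq by (simp add: inner_axis' \<mu>_law)
    then have "?S l $ 1 $ 1 = v"
      by (rule normal_law_inject) (use v stationary_covariance_posdef[OF params] in auto)
    then have eq: "(cg * (cf + k\<^sup>2 * cg) + l * cf\<^sup>2 * cg\<^sup>2) / ((cf + k\<^sup>2 * cg) * (1 + l * cf * cg)) = cf * cg / (cf + k\<^sup>2 * cg)"
      by (simp only: stationary_covariance_simps v_def)
    have cancel: "x = y * q" if "x / (p * q) = y / p" "p > 0" "q > 0" for x y p q :: real
      using that by (simp add: field_simps)
    have "1 + l * cf * cg > 0" using params by (auto intro!: add_pos_pos)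
    from cancel[OF eq P this] have "cg * (cf + k\<^sup>2 * cg) + l * cf\<^sup>2 * cg\<^sup>2 = cf * cg * (1 + l * cf * cg)" .
    then show False using params by (simp add: power2_eq_square algebra_simps)
  qed
  have limit: "weakly_converges \<pi> \<nu> at_top"
  proof (rule gaussian_weakly_converges[OF _ \<nu>_gaussian])
    show "\<forall>\<^sub>F r in at_top. gaussian 0 (?S r) (\<pi> r)"
      using eventually_gt_at_top[of 0] by eventually_elim (rule \<pi>)
    show "S\<nu> $ 1 $ 1 > 0" using v by (simp add: S\<nu>_def)
    show "(?S \<longlongrightarrow> S\<nu>) at_top"
      unfolding S\<nu>_def v_def using params by (intro stationary_covariance_tendsto)
  qed simp
  show ?thesis
  proof (intro conjI exI[of _ \<pi>] allI impI)
    show "h x = (k\<^sup>2 * cg + cf) / (2 * cf * cg) * x\<^sup>2" for x by (rule quad)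
    show "prob_space \<mu>" by (rule \<mu>_prob)
    show "has_smooth_density (distr M borel (Z t))"
      if "linear_sde_solution ?A ?B M F W Z" "0 < t" for M :: "'a measure" and F W Z t
      using that by (rule smooth)
    show "nondegenerate_gaussian (distr M borel (Z t))"
      if "linear_sde_solution ?A ?B M F W Z \<and> is_gaussian (distr M borel (Z 0))" "0 < t"
      for M :: "'a measure" and F W Z t
      using that by (elim conjE) (rule nondeg)
    show "gaussian 0 (?S r) (\<pi> r)" if "0 < r" for r using that by (rule \<pi>)
    show "distr M borel (Z t) = \<pi> l"
      if "linear_sde_solution ?A ?B M F W Z \<and> distr M borel (Z 0) = \<pi> l" "0 \<le> t"
      for M :: "'a measure" and F W Z t
      using that by (elim conjE) (rule stationary)
    show "weakly_converges (\<lambda>t. distr M borel (Z t)) (\<pi> l) at_top"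
      if "linear_sde_solution ?A ?B M F W Z \<and> is_gaussian (distr M borel (Z 0))"
      for M :: "'a measure" and F W Z
      using that by (elim conjE) (rule ergodic)
    show "distr (\<pi> l) borel (\<lambda>z. z $ 1) \<noteq> \<mu>" by (rule neq)
    show "weakly_converges \<pi> \<nu> at_top" by (rule limit)
    show "degenerate_gaussian \<nu>"
      using \<nu>_gaussian \<nu>_sing by (auto simp: degenerate_gaussian_def)
    show "distr \<nu> borel (\<lambda>z. z $ 1) = \<mu>" by (rule \<nu>_marginal)
  qed
qed

end
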